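(* Let $T:\mathbb{R}^n\to\mathbb{R}^n$ be an invertible linear transform. For all $\phi_1,\dots,\phi_n\in Conc(0,\infty)$ and $K_1,\dots,K_n\in C^2_+$, $$as(\phi_1,TK_1;\cdots;\phi_n,TK_n)=as(\phi_1,K_1;\cdots;\phi_n,K_n)\quad\text{if } |\det(T)|=1.$$ If in addition (for arbitrary invertible $T$) the functions $\phi_i$ are homogeneous of degrees $r_i\in[0,1)$ for $i=1,\dots,n$, that is, $\phi_i(t)=\phi_i(1)t^{r_i}$, then $$as(\phi_1,TK_1;\cdots;\phi_n,TK_n)=|\det(T)|^{1-\frac{2\sum_{i=1}^nr_i}{n}}\,as(\phi_1,K_1;\cdots;\phi_n,K_n).$$
   Context: Let $n\ge2$. $S^{n-1}$ is the unit sphere of $\mathbb{R}^n$ and $\sigma$ the usual surface area measure on it. $K\in C^2_+$ means that $K$ is a convex body in $\mathbb{R}^n$ with the origin in its interior and with $C^2$ boundary having everywhere strictly positive Gaussian curvature. $h_K(u)=\max_{x\in K}\langle x,u\rangle$ is the support function, and the curvature function $f_K(u)$, $u\in S^{n-1}$, is the reciprocal of the Gauss curvature of $\partial K$ at the point with outer unit normal $u$. $Conc(0,\infty)$ is the set of functions $\phi:(0,\infty)\to(0,\infty)$ such that either $\phi$ is a nonzero constant function, or $\phi$ is concave with $\lim_{t\to0}\phi(t)=0$ and $\lim_{t\to\infty}\phi(t)/t=0$. $\phi$ is homogeneous of degree $r$ if $\phi(\lambda t)=\lambda^r\phi(t)$ for all $\lambda,t>0$. The general mixed $L_\phi$-affine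 surface area, for $\phi_i\in Conc(0,\infty)$ and $K_i\in C^2_+$, is $$as(\phi_1,K_1;\cdots;\phi_n,K_n)=\int_{S^{n-1}}\prod_{i=1}^n\left[\phi_i\!\left(\frac{1}{f_{K_i}(u)h_{K_i}^{n+1}(u)}\right)h_{K_i}(u)f_{K_i}(u)\right]^{\frac1n}d\sigma(u).$$ *)

theory Defs
  imports "HOL-Analysis.Analysis"
begin

(* Spherical measure from polar coordinates: sigma(A) = n * vol {t u | 0 < t < 1, u in A}.
   The weight n makes the polar formula  dx = r^(n-1) dr dsigma  hold, so the total mass
   is n times the volume of the unit ball. *)
definition sphere_measure :: "(real ^ 'n) measure" where
  "sphere_measure =
     scale_measure (of_nat CARD('n))
       (distr (restrict_space lborel (ball 0 1 - {0}))
              (restrict_space borel (sphere 0 1))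
              (\<lambda>x. x /\<^sub>R norm x))"

definition support_function :: "(real ^ 'n) set \<Rightarrow> real ^ 'n \<Rightarrow> real" where
  "support_function K u = (SUP x\<in>K. x \<bullet> u)"

definition C2_with_gradient ::
    "(real ^ 'n) set \<Rightarrow> (real ^ 'n \<Rightarrow> real) \<Rightarrow> (real ^ 'n \<Rightarrow> real ^ 'n) \<Rightarrow> bool" where
  "C2_with_gradient U F G \<longleftrightarrow>
     (\<forall>x\<in>U. (F has_derivative (\<lambda>v. G x \<bullet> v)) (at x)) \<and>
     (\<exists>H :: real ^ 'n \<Rightarrow> real ^ 'n ^ 'n.
        (\<forall>x\<in>U. (G has_derivative (\<lambda>v. H x *v v)) (at x)) \<and> continuous_on U H)"

definition C2_boundary :: "(real ^ 'n) set \<Rightarrow> bool" where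
  "C2_boundary K \<longleftrightarrow>
     (\<forall>x\<in>frontier K. \<exists>U F G. open U \<and> x \<in> U \<and> C2_with_gradient U F G \<and>
        (\<forall>y\<in>U. G y \<noteq> 0) \<and> K \<inter> U = {y \<in> U. F y \<le> 0})"

definition is_outer_unit_normal :: "(real ^ 'n) set \<Rightarrow> real ^ 'n \<Rightarrow> real ^ 'n \<Rightarrow> bool" where
  "is_outer_unit_normal K x u \<longleftrightarrow>
     x \<in> frontier K \<and> norm u = 1 \<and> (\<forall>y\<in>K. (y - x) \<bullet> u \<le> 0)"

definition gauss_map :: "(real ^ 'n) set \<Rightarrow> real ^ 'n \<Rightarrow> real ^ 'n" where
  "gauss_map K x = (THE u. is_outer_unit_normal K x u)"

(* Determinant of the Weingarten map, i.e. of the differential W of the Gauss map on the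
   tangent space at x (the orthogonal complement of the normal u).  Being taken within the
   frontier, the derivative determines W only on tangent vectors.  To express the
   determinant of its restriction to the tangent space by an n x n matrix, that restriction
   is extended by the identity on the normal line.  The outer normal is used, so the
   principal curvatures of a convex body are nonnegative. *)
definition gauss_curvature :: "(real ^ 'n) set \<Rightarrow> real ^ 'n \<Rightarrow> real" where
  "gauss_curvature K x =
     (THE \<kappa>. \<exists>W. (gauss_map K has_derivative W) (at x within frontier K) \<and>
        \<kappa> = (let u = gauss_map K x
             in det (matrix (\<lambda>v. W (v - (v \<bullet> u) *\<^sub>R u) + (v \<bullet> u) *\<^sub>R u))))"

definition C2_plus :: "(real ^ 'n) set set" where
  "C2_plus = {K. convex K \<and> compact K \<and> 0 \<in> interior K \<and> C2_boundary K \<and>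
                 (\<forall>x\<in>frontier K. gauss_curvature K x > 0)}"

definition curvature_function :: "(real ^ 'n) set \<Rightarrow> real ^ 'n \<Rightarrow> real" where
  "curvature_function K u = 1 / gauss_curvature K (THE x. is_outer_unit_normal K x u)"

(* Functions on (0, infinity) are total functions of which only the values at positive
   arguments matter. *)
definition Conc :: "(real \<Rightarrow> real) set" where
  "Conc = {\<phi>. (\<forall>t>0. \<phi> t > 0) \<and>
     ((\<exists>c. c \<noteq> 0 \<and> (\<forall>t>0. \<phi> t = c)) \<or>
      (concave_on {0<..} \<phi> \<and> (\<phi> \<longlongrightarrow> 0) (at_right 0) \<and>
       ((\<lambda>t. \<phi> t / t) \<longlongrightarrow> 0) at_top))}"

definition homogeneous_of_degree :: "real \<Rightarrow> (real \<Rightarrow> real) \<Rightarrow> bool" where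
  "homogeneous_of_degree r \<phi> \<longleftrightarrow> (\<forall>s>0. \<forall>t>0. \<phi> (s * t) = s powr r * \<phi> t)"

definition mixed_affine_surface_area ::
    "(nat \<Rightarrow> real \<Rightarrow> real) \<Rightarrow> (nat \<Rightarrow> (real ^ 'n) set) \<Rightarrow> real" where
  "mixed_affine_surface_area \<phi> K =
     (\<integral>u. (\<Prod>i=1..CARD('n).
        (\<phi> i (1 / (curvature_function (K i) u * support_function (K i) u ^ (CARD('n) + 1)))
          * support_function (K i) u * curvature_function (K i) u) powr (1 / CARD('n)))
      \<partial>sphere_measure)"

end

theory Submission
  imports Defs
begin

text \<open>
  Let \<open>A\<close> be the inverse transpose of \<open>T\<close>, let \<open>u\<close> be a unit vector and \<open>v\<close> the normalization of
  \<open>T\<^sup>t u\<close>. The Gauss map of \<open>T K\<close> at \<open>T x\<close> is the normalization of \<open>A\<close> applied to that of \<open>K\<close> at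
  \<open>x\<close>. Differentiating gives \<open>f\<^sub>T\<^sub>K(u) = det(T)\<^sup>2 |T\<^sup>t u|\<^sup>-\<^sup>(\<^sup>n\<^sup>+\<^sup>1\<^sup>) f\<^sub>K(v)\<close>, while
  \<open>h\<^sub>T\<^sub>K(u) = |T\<^sup>t u| h\<^sub>K(v)\<close>. Hence the arguments of the \<open>\<phi>\<^sub>i\<close> are only divided by \<open>det(T)\<^sup>2\<close>, the
  products \<open>h f\<close> pick up the factor \<open>det(T)\<^sup>2 |T\<^sup>t u|\<^sup>-\<^sup>n\<close>, and \<open>|T\<^sup>t u|\<^sup>-\<^sup>n d\<sigma>(u)\<close> is
  mapped to \<open>|det T|\<^sup>-\<^sup>1 d\<sigma>(v)\<close>.
\<close>

section \<open>Determinants and rank-one perturbations\<close>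

text \<open>The curvature is a definite description over derivatives within
  \<open>frontier K\<close>, and such a derivative is pinned down on tangent vectors only. The
  extension along the normal line evaluates it only there, so the described value is unique once
  every tangent vector is a limit of chords. Positive curvature excludes boundary segments with a
  common normal, so the point described in \<open>curvature_function\<close> exists uniquely.
  Instead of membership in \<open>C2_plus\<close>, the images inherit \<open>smooth_body\<close>;
  the boundary point of an image with a given normal is read off from \<open>K\<close>. The
  exponents: the two factors \<open>det T\<close> stem from \<open>S\<close> and its adjoint; in the
  power \<open>n + 1\<close> of the norm, \<open>n\<close> comes from scaling an n x n matrix by 1/a
  and one more from the correction that restores the normal component. The weight
  \<open>h^(n+1)\<close> in the argument of each \<open>\<phi> i\<close> is what cancels this norm.
  The spherical measure is the volume of cones in the ball. A linear map turns the ball into an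
  ellipsoid, so a change of variables does not finish the argument; the density on the sphere is
  exactly what exchanges the ellipsoid for the ball.\<close>

lemma det_id_plus_rank_one:
  fixes p :: "real^'n"
  assumes "linear g"
  shows "det (matrix (\<lambda>v. v + g v *\<^sub>R p)) = 1 + g p"
proof (cases "p = 0")
  case True
  then show ?thesis
    using linear_0[OF assms] by (simp add: matrix_id_mat_1[unfolded id_def])
next
  case False
  \<comment> \<open>The index \<open>k\<close> is arbitrary. A rotation \<open>O'\<close> turns
    \<open>g\<close> into a multiple of the single coordinate \<open>k\<close>, so that the
    conjugated map differs from the identity in column \<open>k\<close> only.\<close>
  define k :: 'n where "k = undefined"
  define e :: "real^'n" where e: "e = axis k 1"
  obtain q where q: "\<And>v. g v = q \<bullet> v"
    using assms by (metis adjoint_works inner_commute inner_real_def mult.right_neutral)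
  show ?thesis
  proof (cases "q = 0")
    case True
    then show ?thesis by (simp add: q matrix_id_mat_1[unfolded id_def])
  next
    case False
    define n where "n = q /\<^sub>R norm q"
    have "norm n = norm e" using False by (simp add: n_def e)
    then obtain O' where O': "orthogonal_transformation O'" "O' e = n"
      using orthogonal_transformation_exists[of e n] by metis
    have lin: "linear O'" using O' orthogonal_transformation_linear by blast
    obtain P where P: "linear P" "P \<circ> O' = id" "O' \<circ> P = id"
      using O' orthogonal_transformation_inj orthogonal_transformation_surj lin
      by (metis linear_injective_left_inverse linear_inverse_left)
    define f where "f = (\<lambda>v. v + g v *\<^sub>R p)"
    have linf: "linear f" unfolding f_def
      by (auto intro!: linearI simp: linear_add[OF assms] linear_scale[OF assms] algebra_simps)
    define x where "x = e + norm q *\<^sub>R P p"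
    have PO: "P (O' v) = v" "O' (P v) = v" for v using P by (metis comp_apply id_apply)+
    have gO: "g (O' v) = norm q * (e \<bullet> v)" for v
    proof -
      have "g (O' v) = norm q * (n \<bullet> O' v)" using False by (simp add: q n_def)
      also have "n \<bullet> O' v = e \<bullet> v" using O' by (metis orthogonal_transformation_def)
      finally show ?thesis .
    qed
    have "P (f (O' v)) = v + (e \<bullet> v) *\<^sub>R (norm q *\<^sub>R P p)" for v
      by (simp add: f_def gO linear_add[OF P(1)] linear_scale[OF P(1)] PO)
    hence eq: "P \<circ> f \<circ> O' = (\<lambda>v. v + (v $ k) *\<^sub>R (norm q *\<^sub>R P p))"
      by (auto simp: e inner_axis' fun_eq_iff)
    \<comment> \<open>The identity matrix with column \<open>k\<close> replaced by \<open>x\<close>: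
      Cramer's rule gives its determinant as \<open>x $ k\<close>.\<close>
    have "matrix (P \<circ> f \<circ> O') = (\<chi> i j. if j = k then (mat 1 *v x) $ i else (mat 1 :: real^'n^'n) $ i $ j)"
      unfolding eq matrix_vector_mul_lid by (simp add: matrix_def vec_eq_iff x_def e axis_def mat_def)
    hence "det (matrix (P \<circ> f \<circ> O')) = x $ k"
      using cramer_lemma[of k "mat 1 :: real^'n^'n" x] by simp
    moreover have "det (matrix (P \<circ> f \<circ> O')) = det (matrix P) * det (matrix f) * det (matrix O')"
      using matrix_compose[OF lin linear_compose[OF linf P(1)]] matrix_compose[OF linf P(1)]
      by (simp add: det_mul o_assoc)
    moreover have "det (matrix P) * det (matrix O') = 1"
      using matrix_compose[OF lin P(1)] P(2) by (metis det_I det_mul matrix_id_mat_1)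
    moreover have "x $ k = 1 + g p"
      using gO[of "P p"] by (simp add: PO x_def e inner_axis')
    ultimately have "det (matrix f) = 1 + g p"
      by (metis mult.assoc mult.commute mult.right_neutral)
    then show ?thesis by (simp add: f_def)
  qed
qed

lemma det_matrix_compose:
  fixes f g :: "real^'n \<Rightarrow> real^'n"
  assumes "linear f" "linear g"
  shows "det (matrix (f \<circ> g)) = det (matrix f) * det (matrix g)"
  using assms by (simp add: matrix_compose det_mul)

lemma det_matrix_scale:
  fixes f :: "real^'n \<Rightarrow> real^'n"
  shows "det (matrix (\<lambda>v. c *\<^sub>R f v)) = c ^ CARD('n) * det (matrix f)"
proof -
  have "matrix (\<lambda>v. c *\<^sub>R f v) = (\<chi> i. c *s (matrix f $ i))"
    by (simp add: matrix_def vec_eq_iff)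
  then show ?thesis
    using det_rows_mul[of "\<lambda>_. c" "\<lambda>i. matrix f $ i"] by simp
qed

text \<open>The linear map whose determinant \<open>gauss_curvature\<close> takes. For a unit vector
  \<open>u\<close> it feeds \<open>W\<close> only with vectors orthogonal to
  \<open>u\<close>.\<close>

definition tangent_extension :: "real^'n \<Rightarrow> (real^'n \<Rightarrow> real^'n) \<Rightarrow> real^'n \<Rightarrow> real^'n" where
  "tangent_extension u W v = W (v - (v \<bullet> u) *\<^sub>R u) + (v \<bullet> u) *\<^sub>R u"

lemma linear_tangent_extension [intro]:
  assumes "linear W"
  shows "linear (tangent_extension u W)"
  unfolding tangent_extension_def
  by (auto intro!: linearI simp: linear_add[OF assms] linear_diff[OF assms] linear_scale[OF assms]
    algebra_simps inner_add_left)

text \<open>Up to the factor \<open>1/a\<close>, the composition of the extension of \<open>V\<close> with the rank-one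
  perturbation \<open>Q\<close> of the identity is the composition of \<open>A\<close>, the extension of \<open>W\<close>, \<open>S\<close> and
  another such perturbation \<open>R\<close>; this avoids choosing bases of the two tangent spaces.\<close>
lemma det_tangent_extension_image:
  fixes W T S :: "real^'n \<Rightarrow> real^'n"
  assumes W: "linear W" and T: "linear T" and S: "linear S"
    and TS: "T \<circ> S = id" and ST: "S \<circ> T = id" and u: "norm u = 1"
  defines "A \<equiv> adjoint S"
  defines "a \<equiv> norm (A u)"
  defines "n \<equiv> A u /\<^sub>R a"
  defines "V \<equiv> (\<lambda>v. (A (W (S v)) - (A (W (S v)) \<bullet> n) *\<^sub>R n) /\<^sub>R a)"
  shows "det (matrix (tangent_extension n V)) * (a ^ (CARD('n) + 1) * (det (matrix T))\<^sup>2)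
         = det (matrix (tangent_extension u W))"
proof -
  have A: "linear A" unfolding A_def using S by (rule adjoint_linear)
  have Aw: "A x \<bullet> y = x \<bullet> S y" for x y unfolding A_def
    by (metis S adjoint_works inner_commute)
  have TS': "T (S x) = x" "S (T x) = x" for x using TS ST by (metis comp_apply id_apply)+
  have uu: "u \<bullet> u = 1" using u by (simp add: dot_square_norm)
  have "A u \<noteq> 0"
    using Aw[of u "T u"] uu by (auto simp: TS')
  hence a0: "a > 0" by (simp add: a_def)
  have An: "A u = a *\<^sub>R n" using a0 by (simp add: n_def)
  have nn: "n \<bullet> n = 1"
    using a0 by (simp add: n_def a_def dot_square_norm power2_eq_square)
  have Su: "S v \<bullet> u = a * (v \<bullet> n)" for v
    using Aw[of u v] An by (simp add: inner_commute)
  have Tun: "a * (T u \<bullet> n) = 1" using Su[of "T u"] uu by (simp add: TS')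
  define M where "M = tangent_extension u W"
  have M: "linear M" unfolding M_def using W by blast
  \<comment> \<open>\<open>R\<close> fixes the complement of \<open>n\<close> and sends
    \<open>n\<close> to \<open>a *\<^sub>R T u\<close>, so \<open>S \<circ> R\<close> sends
    \<open>n\<close> to a multiple of \<open>u\<close> as the extension by \<open>M\<close>
    requires. Its determinant is 1 because \<open>a *\<^sub>R T u - n\<close> is orthogonal to
    \<open>n\<close>.\<close>
  define R where "R = (\<lambda>v. v + (v \<bullet> n) *\<^sub>R (a *\<^sub>R T u - n))"
  have linn: "linear (\<lambda>v. v \<bullet> n)" by (simp add: inner_add_left linearI)
  have detR: "det (matrix R) = 1"
    unfolding R_def using det_id_plus_rank_one[OF linn, of "a *\<^sub>R T u - n"]
    by (simp add: inner_diff_left Tun nn)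
  have R: "linear R" unfolding R_def
    by (auto intro!: linearI simp: inner_add_left algebra_simps)
  \<comment> \<open>On the complement of \<open>n\<close>, the first term restores the normal
    component that \<open>V\<close> projects away. The second term makes
    \<open>Q n = a *\<^sub>R n\<close>, matching the value of the other composition at
    \<open>n\<close>; this is the source of the extra factor \<open>a\<close>.\<close>
  define g where "g = (\<lambda>v. inverse a * (A (W (S (v - (v \<bullet> n) *\<^sub>R n))) \<bullet> n) + (a - 1) * (v \<bullet> n))"
  have g: "linear g" unfolding g_def
    by (auto intro!: linearI simp: linear_add[OF A] linear_diff[OF A] linear_scale[OF A]
      linear_add[OF W] linear_diff[OF W] linear_scale[OF W]
      linear_add[OF S] linear_diff[OF S] linear_scale[OF S] inner_add_left inner_diff_left algebra_simps)
  define Q where "Q = (\<lambda>v. v + g v *\<^sub>R n)"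
  have gn: "g n = a - 1"
    by (simp add: g_def nn linear_0[OF S] linear_0[OF W] linear_0[OF A])
  have detQ: "det (matrix Q) = a"
    unfolding Q_def using det_id_plus_rank_one[OF g, of n] gn by simp
  have Q: "linear Q" unfolding Q_def
    by (auto intro!: linearI simp: linear_add[OF g] linear_scale[OF g] algebra_simps)
  have V: "linear V" unfolding V_def
    by (auto intro!: linearI simp: linear_add[OF A] linear_diff[OF A] linear_scale[OF A]
      linear_add[OF W] linear_diff[OF W] linear_scale[OF W]
      linear_add[OF S] linear_diff[OF S] linear_scale[OF S] inner_add_left inner_diff_left algebra_simps)
  have key: "tangent_extension n V (Q v) = inverse a *\<^sub>R A (M (S (R v)))" for v
  proof -
    define z where "z = v - (v \<bullet> n) *\<^sub>R n"
    have zn: "z \<bullet> n = 0" by (simp add: z_def inner_diff_left nn)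
    have 1: "Q v - (Q v \<bullet> n) *\<^sub>R n = z"
      by (simp add: Q_def z_def inner_add_left nn algebra_simps)
    have 2: "Q v \<bullet> n = inverse a * (A (W (S z)) \<bullet> n) + a * (v \<bullet> n)"
      by (simp add: Q_def g_def inner_add_left nn z_def algebra_simps)
    have lhs: "tangent_extension n V (Q v) = inverse a *\<^sub>R A (W (S z)) + (a * (v \<bullet> n)) *\<^sub>R n"
      unfolding tangent_extension_def 1 unfolding 2 V_def
      by (simp add: algebra_simps)
    have Rv: "R v = z + ((v \<bullet> n) * a) *\<^sub>R T u" by (simp add: R_def z_def algebra_simps)
    have SR: "S (R v) = S z + ((v \<bullet> n) * a) *\<^sub>R u"
      by (simp add: Rv linear_add[OF S] linear_scale[OF S] TS')
    have "S (R v) \<bullet> u = (v \<bullet> n) * a" using Su[of z] zn uu by (simp add: SR inner_add_left)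
    hence "M (S (R v)) = W (S z) + ((v \<bullet> n) * a) *\<^sub>R u"
      by (simp add: M_def tangent_extension_def SR)
    hence "A (M (S (R v))) = A (W (S z)) + ((v \<bullet> n) * a * a) *\<^sub>R n"
      by (simp add: linear_add[OF A] linear_scale[OF A] An)
    then show ?thesis using a0 by (simp add: lhs algebra_simps)
  qed
  have "tangent_extension n V \<circ> Q = (\<lambda>v. inverse a *\<^sub>R (A \<circ> (M \<circ> (S \<circ> R))) v)"
    using key by (auto simp: fun_eq_iff)
  moreover have "det (matrix (tangent_extension n V \<circ> Q)) = det (matrix (tangent_extension n V)) * a"
    using det_matrix_compose[OF linear_tangent_extension[OF V] Q] detQ by simp
  moreover have "det (matrix (A \<circ> (M \<circ> (S \<circ> R)))) = det (matrix A) * (det (matrix M) * (det (matrix S) * 1))"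
    by (simp only: det_matrix_compose linear_compose A M S R detR)
  ultimately have "det (matrix (tangent_extension n V)) * a
       = inverse a ^ CARD('n) * (det (matrix A) * (det (matrix M) * (det (matrix S) * 1)))"
    by (simp only: det_matrix_scale)
  moreover have "det (matrix A) = det (matrix S)"
    unfolding A_def by (simp add: matrix_adjoint[OF S])
  moreover have ST1: "det (matrix S) * det (matrix T) = 1"
    using det_matrix_compose[OF S T] ST by (simp add: matrix_id_mat_1)
  ultimately have "det (matrix (tangent_extension n V)) * a
      = inverse a ^ CARD('n) * det (matrix M) * (det (matrix S))\<^sup>2"
    by (simp add: power2_eq_square)
  hence "(det (matrix (tangent_extension n V)) * a) * a ^ CARD('n) * (det (matrix T))\<^sup>2
     = (a * inverse a) ^ CARD('n) * det (matrix M) * (det (matrix S) * det (matrix T))\<^sup>2"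
    by (simp add: power_mult_distrib)
  then show ?thesis using a0 by (simp add: ST1 M_def mult.assoc)
qed

section \<open>Normals and curvature of convex bodies\<close>

lemma outer_unit_normalI:
  assumes "x \<in> K" "norm u = 1" "\<And>y. y \<in> K \<Longrightarrow> y \<bullet> u \<le> x \<bullet> u"
  shows "is_outer_unit_normal K x u"
proof -
  have "x \<notin> interior K"
  proof
    assume "x \<in> interior K"
    then obtain e where e: "e > 0" "cball x e \<subseteq> K" by (meson mem_interior_cball)
    then have "x + e *\<^sub>R u \<in> K" using assms(2) by (auto simp: dist_norm)
    then have "(x + e *\<^sub>R u) \<bullet> u \<le> x \<bullet> u" using assms(3) by blast
    then show False using e assms(2) by (simp add: inner_add_left dot_square_norm)
  qed
  moreover have "x \<in> closure K" using assms(1) closure_subset by blast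
  ultimately show ?thesis
    using assms by (simp add: is_outer_unit_normal_def frontier_def inner_diff_left)
qed

lemma outer_unit_normalD:
  assumes "is_outer_unit_normal K x u"
  shows "x \<in> frontier K" "norm u = 1" "\<And>y. y \<in> K \<Longrightarrow> y \<bullet> u \<le> x \<bullet> u"
  using assms by (auto simp: is_outer_unit_normal_def inner_diff_left)

lemma ex_outer_unit_normal:
  fixes K :: "(real^'n) set"
  assumes "convex K" "interior K \<noteq> {}" "x \<in> frontier K"
  shows "\<exists>u. is_outer_unit_normal K x u"
proof -
  have "x \<in> closure K" "x \<notin> rel_interior K"
    using assms by (auto simp: frontier_def rel_interior_nonempty_interior)
  then obtain a where a: "a \<noteq> 0" "\<And>y. y \<in> closure K \<Longrightarrow> a \<bullet> x \<le> a \<bullet> y"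
    using supporting_hyperplane_relative_frontier[OF assms(1)] by metis
  have "is_outer_unit_normal K x (sgn (-a))"
    unfolding is_outer_unit_normal_def
  proof (intro conjI ballI)
    show "norm (sgn (-a)) = 1" using a by (simp add: norm_sgn)
    fix y assume "y \<in> K"
    hence "a \<bullet> x \<le> a \<bullet> y" using a closure_subset by blast
    hence "(y - x) \<bullet> a \<ge> 0" by (simp add: inner_diff_left inner_diff_right inner_commute)
    then show "(y - x) \<bullet> sgn (- a) \<le> 0" by (simp add: sgn_div_norm)
  qed (rule assms(3))
  then show ?thesis by blast
qed

lemma ex_point_with_outer_unit_normal:
  assumes "compact K" "K \<noteq> {}" "norm u = 1"
  shows "\<exists>x. is_outer_unit_normal K x u"
proof -
  have "continuous_on K (\<lambda>y. y \<bullet> u)" by (intro continuous_intros)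
  then obtain x where "x \<in> K" "\<forall>y\<in>K. y \<bullet> u \<le> x \<bullet> u"
    using continuous_attains_sup[OF assms(1,2)] by metis
  then show ?thesis using outer_unit_normalI[of x K u] assms(3) by blast
qed

text \<open>A direction with negative inner product with the gradient strictly decreases the
  defining function to first order, so short steps stay in its sublevel set. The gradient field is
  exported together with its derivative at \<open>x\<close> because its normalization will be the
  Gauss map near \<open>x\<close>.\<close>

lemma C2_boundary_moves_inward:
  assumes K: "closed K" and b: "C2_boundary K" and x: "x \<in> frontier K"
  obtains U G H where "open U" "x \<in> U" "\<And>y. y \<in> U \<Longrightarrow> G y \<noteq> 0"
    "(G has_derivative H) (at x)"
    "\<And>y w. y \<in> U \<Longrightarrow> y \<in> frontier K \<Longrightarrow> w \<bullet> G y < 0 \<Longrightarrow> \<exists>d>0. \<forall>t. 0 < t \<and> t < d \<longrightarrow> y + t *\<^sub>R w \<in> K"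
proof -
  obtain U F G where U: "open U" "x \<in> U" "C2_with_gradient U F G" "\<forall>y\<in>U. G y \<noteq> 0"
     "K \<inter> U = {y\<in>U. F y \<le> 0}"
    using bspec[OF b[unfolded C2_boundary_def] x] by (elim exE conjE)
  obtain H where H: "(G has_derivative H) (at x)"
    using U(2,3) unfolding C2_with_gradient_def by metis
  have "\<exists>d>0. \<forall>t. 0 < t \<and> t < d \<longrightarrow> y + t *\<^sub>R w \<in> K"
    if y: "y \<in> U" "y \<in> frontier K" and w: "w \<bullet> G y < 0" for y w
  proof -
    have "y \<in> K" using y K by (simp add: frontier_def)
    hence Fy: "F y \<le> 0" using U(5) y by blast
    obtain e where e: "e > 0" "ball y e \<subseteq> U" using U(1) y open_contains_ball by metis
    have "(F has_derivative (\<lambda>v. G y \<bullet> v)) (at y)"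
      using U(3) y unfolding C2_with_gradient_def by metis
    hence F': "(F has_derivative (\<lambda>v. G y \<bullet> v)) (at (y + 0 *\<^sub>R w))" by simp
    have "((\<lambda>t. F (y + t *\<^sub>R w)) has_derivative (\<lambda>t. G y \<bullet> (t *\<^sub>R w))) (at 0)"
      by (rule has_derivative_compose[where f = "\<lambda>t. y + t *\<^sub>R w", OF _ F'])
         (auto intro!: derivative_eq_intros)
    hence "((\<lambda>t. F (y + t *\<^sub>R w)) has_real_derivative (G y \<bullet> w)) (at 0)"
      by (simp add: has_field_derivative_def mult.commute[of _ "G y \<bullet> w"])
    from DERIV_neg_dec_right[OF this] w
    obtain d where d: "d > 0" "\<And>h. 0 < h \<Longrightarrow> h < d \<Longrightarrow> F (y + h *\<^sub>R w) < F y"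
      by (auto simp: inner_commute)
    have nw: "norm w > 0" using w by auto
    show ?thesis
    proof (intro exI[of _ "min d (e / norm w)"] conjI allI impI)
      show "0 < min d (e / norm w)" using d e nw by simp
      fix t assume t: "0 < t \<and> t < min d (e / norm w)"
      have "y + t *\<^sub>R w \<in> ball y e" using t nw by (simp add: dist_norm field_simps)
      hence "y + t *\<^sub>R w \<in> U" using e by blast
      moreover have "F (y + t *\<^sub>R w) \<le> 0" using d(2)[of t] t Fy by auto
      ultimately show "y + t *\<^sub>R w \<in> K" using U(5) by blast
    qed
  qed
  then show ?thesis using that[of U G H] U(1,2,4) H by simp
qed

text \<open>If the unit vectors \<open>u\<close> and \<open>sgn G\<close> differed,
  \<open>u - sgn G\<close> would lead into the body and yet have positive inner product with
  \<open>u\<close>, crossing the supporting hyperplane. \<open>G\<close> is abstract because it is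
  the gradient of a defining function in some uses and a unit normal in another.\<close>

lemma outer_unit_normal_eq_sgn:
  assumes n: "is_outer_unit_normal K y u" and G: "G \<noteq> 0"
    and inw: "\<And>w. w \<bullet> G < 0 \<Longrightarrow> \<exists>d>0. \<forall>t. 0 < t \<and> t < d \<longrightarrow> y + t *\<^sub>R w \<in> K"
  shows "u = sgn G"
proof (rule ccontr)
  assume ne: "u \<noteq> sgn G"
  have G': "G = norm G *\<^sub>R sgn G" using G by (simp add: sgn_div_norm)
  have u1: "norm u = 1" using outer_unit_normalD[OF n] by blast
  have s1: "norm (sgn G) = 1" using G by (simp add: norm_sgn)
  have "(norm (u - sgn G))\<^sup>2 > 0" using ne by simp
  hence lt: "u \<bullet> sgn G < 1"
    using u1 s1 by (simp add: power2_norm_eq_inner inner_diff_left inner_diff_right inner_commute)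
      (simp add: dot_square_norm)
  have "(u - sgn G) \<bullet> G = norm G * ((u - sgn G) \<bullet> sgn G)" using G' by (metis inner_scaleR_right)
  also have "\<dots> < 0" using lt G s1 by (simp add: inner_diff_left dot_square_norm mult_pos_neg)
  finally obtain d where d: "d > 0" "\<forall>t. 0 < t \<and> t < d \<longrightarrow> y + t *\<^sub>R (u - sgn G) \<in> K" using inw by blast
  hence "y + (d/2) *\<^sub>R (u - sgn G) \<in> K" by simp
  hence "(d/2) * ((u - sgn G) \<bullet> u) \<le> 0"
    using outer_unit_normalD(3)[OF n] by (fastforce simp: inner_add_left)
  hence "(u - sgn G) \<bullet> u \<le> 0" using d by (simp add: mult_le_0_iff)
  thus False using lt u1 by (simp add: inner_diff_left dot_square_norm inner_commute[of "sgn G" u])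
qed

section \<open>From a defining function to the Gauss map and its differential\<close>

lemma has_derivative_sgn:
  fixes w :: "'a::real_inner"
  assumes "w \<noteq> 0"
  shows "(sgn has_derivative (\<lambda>z. (z - (z \<bullet> sgn w) *\<^sub>R sgn w) /\<^sub>R norm w)) (at w)"
proof -
  have nw: "norm w \<noteq> 0" using assms by simp
  have "((\<lambda>z. inverse (norm z)) has_derivative (\<lambda>h. - (inverse (norm w) * (h \<bullet> sgn w) * inverse (norm w)))) (at w)"
    by (rule Deriv.has_derivative_inverse[OF nw has_derivative_norm[OF assms]])
  from has_derivative_scaleR[OF this has_derivative_ident]
  moreover have "sgn = (\<lambda>z::'a. z /\<^sub>R norm z)"
    by (simp add: fun_eq_iff sgn_div_norm)
  ultimately show ?thesis
    by (simp add: sgn_div_norm[of w] algebra_simps)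
qed

text \<open>What is needed of a \<open>C\<^sup>2\<close> boundary in a form that linear maps visibly preserve: the inward
  directions force the normal to be unique and make every tangent vector a limit of chords.\<close>
definition smooth_body :: "(real^'n) set \<Rightarrow> bool" where
  "smooth_body K \<longleftrightarrow> (\<forall>x\<in>frontier K. \<exists>u. is_outer_unit_normal K x u \<and>
     (\<forall>w. w \<bullet> u < 0 \<longrightarrow> (\<exists>d>0. \<forall>t. 0 < t \<and> t < d \<longrightarrow> x + t *\<^sub>R w \<in> K)))"

text \<open>The normal supplied by \<open>smooth_body\<close> can itself play the role of the
  gradient in \<open>outer_unit_normal_eq_sgn\<close>. This makes the normal unique and gives the
  description in \<open>gauss_map\<close> its meaning.\<close>

lemma smooth_body_gauss_map:
  fixes K :: "(real^'n) set"
  assumes K: "smooth_body K"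
  shows smooth_body_gauss_map_eq: "is_outer_unit_normal K x u \<Longrightarrow> gauss_map K x = u"
    and smooth_body_gauss_map_normal: "x \<in> frontier K \<Longrightarrow> is_outer_unit_normal K x (gauss_map K x)"
    and smooth_body_inward: "x \<in> frontier K \<Longrightarrow> w \<bullet> gauss_map K x < 0 \<Longrightarrow>
       \<exists>d>0. \<forall>t. 0 < t \<and> t < d \<longrightarrow> x + t *\<^sub>R w \<in> K"
proof -
  have *: "gauss_map K x = u \<and> (w \<bullet> u < 0 \<longrightarrow> (\<exists>d>0. \<forall>t. 0 < t \<and> t < d \<longrightarrow> x + t *\<^sub>R w \<in> K))"
    if n: "is_outer_unit_normal K x u" for x u w
  proof -
    obtain a where a: "is_outer_unit_normal K x a"
      "\<And>w. w \<bullet> a < 0 \<Longrightarrow> \<exists>d>0. \<forall>t. 0 < t \<and> t < d \<longrightarrow> x + t *\<^sub>R w \<in> K"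
      using bspec[OF K[unfolded smooth_body_def] outer_unit_normalD(1)[OF n]] by blast
    have a1: "norm a = 1" using outer_unit_normalD[OF a(1)] by blast
    hence "sgn a = a" "a \<noteq> 0" by (auto simp: sgn_div_norm)
    hence "b = a" if "is_outer_unit_normal K x b" for b
      using outer_unit_normal_eq_sgn[OF that _ a(2)] by simp
    then show ?thesis using n a unfolding gauss_map_def by blast
  qed
  show "is_outer_unit_normal K x u \<Longrightarrow> gauss_map K x = u" using * by blast
  assume "x \<in> frontier K"
  then obtain u where u: "is_outer_unit_normal K x u"
    using K unfolding smooth_body_def by meson
  show "is_outer_unit_normal K x (gauss_map K x)" using u *[OF u] by simp
  show "w \<bullet> gauss_map K x < 0 \<Longrightarrow> \<exists>d>0. \<forall>t. 0 < t \<and> t < d \<longrightarrow> x + t *\<^sub>R w \<in> K"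
    using *[OF u] by blast
qed

lemma C2_plus_smooth_body:
  assumes "K \<in> C2_plus"
  shows "smooth_body K"
  unfolding smooth_body_def
proof
  fix x assume x: "x \<in> frontier K"
  have K: "closed K" "C2_boundary K" "convex K" "interior K \<noteq> {}"
    using assms by (auto simp: C2_plus_def compact_imp_closed)
  obtain U G H where UG: "x \<in> U" "\<And>y. y \<in> U \<Longrightarrow> G y \<noteq> 0"
    "\<And>y w. y \<in> U \<Longrightarrow> y \<in> frontier K \<Longrightarrow> w \<bullet> G y < 0 \<Longrightarrow> \<exists>d>0. \<forall>t. 0 < t \<and> t < d \<longrightarrow> y + t *\<^sub>R w \<in> K"
    by (rule C2_boundary_moves_inward[OF K(1,2) x]) blast
  obtain u where u: "is_outer_unit_normal K x u"
    using ex_outer_unit_normal[OF K(3,4) x] by blast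
  have "u = sgn (G x)"
    by (rule outer_unit_normal_eq_sgn[OF u UG(2)[OF UG(1)] UG(3)[OF UG(1) x]])
  moreover have "w \<bullet> G x < 0" if "w \<bullet> sgn (G x) < 0" for w
    using that UG(2)[OF UG(1)] by (auto simp: sgn_div_norm mult_less_0_iff)
  ultimately show "\<exists>u. is_outer_unit_normal K x u \<and>
     (\<forall>w. w \<bullet> u < 0 \<longrightarrow> (\<exists>d>0. \<forall>t. 0 < t \<and> t < d \<longrightarrow> x + t *\<^sub>R w \<in> K))"
    using UG(3)[OF UG(1) x] u by blast
qed

text \<open>Positivity of \<open>gauss_curvature\<close> does not by itself supply a derivative,
  since a description without a witness still denotes some number. Differentiability comes from the
  boundary: near \<open>x\<close> the Gauss map is the normalized gradient of a function of class
  C2.\<close>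

lemma C2_plus_gauss_map_differentiable:
  fixes K :: "(real^'n) set"
  assumes "K \<in> C2_plus" and x: "x \<in> frontier K"
  shows "\<exists>W. (gauss_map K has_derivative W) (at x within frontier K)"
proof -
  have K: "closed K" "C2_boundary K" "smooth_body K"
    using assms C2_plus_smooth_body by (auto simp: C2_plus_def compact_imp_closed)
  obtain U G H where UG: "open U" "x \<in> U" "\<And>y. y \<in> U \<Longrightarrow> G y \<noteq> 0" "(G has_derivative H) (at x)"
    "\<And>y w. y \<in> U \<Longrightarrow> y \<in> frontier K \<Longrightarrow> w \<bullet> G y < 0 \<Longrightarrow> \<exists>d>0. \<forall>t. 0 < t \<and> t < d \<longrightarrow> y + t *\<^sub>R w \<in> K"
    by (rule C2_boundary_moves_inward[OF K(1,2) x]) blast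
  have eq: "sgn (G y) = gauss_map K y" if "y \<in> U" "y \<in> frontier K" for y
    using outer_unit_normal_eq_sgn[OF smooth_body_gauss_map_normal[OF K(3) that(2)] UG(3)[OF that(1)] UG(5)[OF that]]
    by simp
  obtain e where e: "e > 0" "ball x e \<subseteq> U" using UG(1,2) open_contains_ball by metis
  have "((\<lambda>y. sgn (G y)) has_derivative
     (\<lambda>v. (H v - (H v \<bullet> sgn (G x)) *\<^sub>R sgn (G x)) /\<^sub>R norm (G x))) (at x)"
    by (rule has_derivative_compose[OF UG(4) has_derivative_sgn[OF UG(3)[OF UG(2)]]])
  from has_derivative_transform_within[OF has_derivative_at_withinI[OF this] e(1) x]
  have "(gauss_map K has_derivative
     (\<lambda>v. (H v - (H v \<bullet> sgn (G x)) *\<^sub>R sgn (G x)) /\<^sub>R norm (G x))) (at x within frontier K)"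
    using eq e(2) by (simp add: dist_commute subset_iff)
  then show ?thesis by blast
qed

text \<open>Tilting \<open>v\<close> slightly inward gives a point of \<open>K\<close>, tilting it
  outward a point beyond the supporting hyperplane. The segment between the two is short, of
  half-length \<open>e * t\<close>, and must cross the frontier.\<close>

lemma tangent_approximation:
  fixes K :: "(real^'n) set"
  assumes K: "smooth_body K" and x: "x \<in> frontier K" and v: "v \<bullet> gauss_map K x = 0"
    and "e > 0" "\<delta> > 0"
  obtains y t where "y \<in> frontier K" "0 < t" "t < \<delta>" "norm (y - x - t *\<^sub>R v) \<le> e * t"
proof -
  define u where "u = gauss_map K x"
  have u: "is_outer_unit_normal K x u"
    using smooth_body_gauss_map_normal[OF K x] by (simp add: u_def)
  have u1: "norm u = 1" "u \<bullet> u = 1" using outer_unit_normalD[OF u] by (auto simp: dot_square_norm)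
  have "(v - e *\<^sub>R u) \<bullet> u < 0" using v u1 \<open>e > 0\<close> by (simp add: inner_diff_left u_def)
  then obtain d where d: "d > 0" "\<And>t. 0 < t \<and> t < d \<Longrightarrow> x + t *\<^sub>R (v - e *\<^sub>R u) \<in> K"
    using smooth_body_inward[OF K x, of "v - e *\<^sub>R u"] unfolding u_def by blast
  define t where "t = min d \<delta> / 2"
  have t: "0 < t" "t < d" "t < \<delta>" using d \<open>\<delta> > 0\<close> by (auto simp: t_def)
  define a where "a = x + t *\<^sub>R (v - e *\<^sub>R u)"
  define b where "b = x + t *\<^sub>R (v + e *\<^sub>R u)"
  have "a \<in> K" using d(2) t by (simp add: a_def)
  have "b \<bullet> u = x \<bullet> u + t * e"
    using v u1 by (simp add: b_def inner_add_left u_def)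
  hence "b \<notin> K" using outer_unit_normalD(3)[OF u, of b] mult_pos_pos[OF t(1) \<open>e > 0\<close>] by auto
  have "closed_segment a b \<inter> frontier K \<noteq> {}"
    by (rule connected_Int_frontier) (use \<open>a \<in> K\<close> \<open>b \<notin> K\<close> in auto)
  then obtain y where y: "y \<in> closed_segment a b" "y \<in> frontier K" by blast
  have "closed_segment a b \<subseteq> cball (x + t *\<^sub>R v) (e * t)"
    by (rule closed_segment_subset)
       (use t \<open>e > 0\<close> u1 in \<open>auto simp: a_def b_def dist_norm algebra_simps\<close>)
  hence "norm (y - x - t *\<^sub>R v) \<le> e * t"
    using y(1) by (auto simp: dist_norm norm_minus_commute diff_diff_eq)
  then show ?thesis using that y t by blast
qed

text \<open>The difference of two derivatives is a derivative of the zero function, hence of small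
  size on short chords from \<open>x\<close>; by \<open>tangent_approximation\<close> such chords
  have directions arbitrarily close to \<open>v\<close>.\<close>

lemma derivative_frontier_unique_on_tangent:
  fixes K :: "(real^'n) set"
  assumes K: "smooth_body K" and x: "x \<in> frontier K" and v: "v \<bullet> gauss_map K x = 0"
    and W1: "(f has_derivative W1) (at x within frontier K)"
    and W2: "(f has_derivative W2) (at x within frontier K)"
  shows "W1 v = W2 v"
proof (rule ccontr)
  assume ne: "W1 v \<noteq> W2 v"
  define D where "D = (\<lambda>v. W1 v - W2 v)"
  have "((\<lambda>y. f y - f y) has_derivative D) (at x within frontier K)"
    unfolding D_def by (rule has_derivative_diff[OF W1 W2])
  hence D: "bounded_linear D"
    "\<And>e. e > 0 \<Longrightarrow> \<exists>d>0. \<forall>y\<in>frontier K. norm (y - x) < d \<longrightarrow> norm (D (y - x)) \<le> e * norm (y - x)"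
    unfolding has_derivative_within_alt by auto
  obtain B where B: "B > 0" "\<And>z. norm (D z) \<le> norm z * B"
    using bounded_linear.pos_bounded[OF D(1)] by blast
  define C where "C = norm v + 1 + B"
  have C: "C > 0" using B by (simp add: C_def add_nonneg_pos)
  have nD: "norm (D v) > 0" using ne by (simp add: D_def)
  \<comment> \<open>In \<open>C\<close>, the part \<open>norm v + 1\<close> bounds
    \<open>norm (y - x) / t\<close> once \<open>e \<le> 1\<close>, and \<open>B\<close> accounts for
    applying \<open>D\<close> to the error of the chord. The final estimate is
    \<open>norm (D v) \<le> e * C\<close>.\<close>
  define e where "e = min 1 (norm (D v) / (2 * C))"
  have e: "e > 0" "e \<le> 1" "e * C < norm (D v)"
  proof -
    show "e > 0" "e \<le> 1" using nD C by (auto simp: e_def)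
    have "e * C \<le> norm (D v) / (2 * C) * C" using C by (intro mult_right_mono) (auto simp: e_def)
    also have "\<dots> = norm (D v) / 2" using C by simp
    finally show "e * C < norm (D v)" using nD by linarith
  qed
  obtain d where d: "d > 0" "\<And>y. y\<in>frontier K \<Longrightarrow> norm (y - x) < d \<Longrightarrow> norm (D (y - x)) \<le> e * norm (y - x)"
    using D(2)[OF e(1)] by metis
  \<comment> \<open>With \<open>t\<close> below this bound, the chord of length at most
    \<open>t * (norm v + 1)\<close> stays within radius \<open>d\<close>.\<close>
  have "d / (norm v + 1) > 0" using d by (simp add: add_nonneg_pos)
  from tangent_approximation[OF K x v e(1) this]
  obtain y t where y: "y \<in> frontier K" "0 < t" "t < d / (norm v + 1)" "norm (y - x - t *\<^sub>R v) \<le> e * t" .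
  have "norm (y - x) \<le> norm (y - x - t *\<^sub>R v) + norm (t *\<^sub>R v)" by (metis diff_add_cancel norm_triangle_ineq)
  also have "\<dots> \<le> 1 * t + t * norm v" using y e by (intro add_mono order.trans[OF y(4)] mult_right_mono) auto
  finally have n1: "norm (y - x) \<le> t * (norm v + 1)" by (simp add: algebra_simps)
  also have "\<dots> < d" using y by (simp add: pos_less_divide_eq add_nonneg_pos)
  finally have n2: "norm (D (y - x)) \<le> e * norm (y - x)" using d(2) y by blast
  have "t *\<^sub>R D v = D (y - x) - D (y - x - t *\<^sub>R v)"
    using bounded_linear.linear[OF D(1)] by (simp add: linear_diff linear_scale)
  hence "t * norm (D v) \<le> norm (D (y - x)) + norm (D (y - x - t *\<^sub>R v))"
    using y by (metis abs_of_pos norm_scaleR norm_triangle_ineq4)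
  also have "\<dots> \<le> e * (t * (norm v + 1)) + (e * t) * B"
    using n2 B(2)[of "y - x - t *\<^sub>R v"] mult_left_mono[OF n1, of e] mult_right_mono[OF y(4), of B] e(1) B(1)
    by linarith
  also have "\<dots> = t * (e * C)" by (simp add: C_def algebra_simps)
  finally have "norm (D v) \<le> e * C" using y by simp
  with e show False by simp
qed

text \<open>Different derivatives within the frontier may disagree on the normal line, but they have
  the same \<open>tangent_extension\<close>; hence the description in \<open>gauss_curvature\<close>
  has exactly one value.\<close>

lemma gauss_curvature_eq_det:
  fixes K :: "(real^'n) set"
  assumes K: "smooth_body K" and x: "x \<in> frontier K"
    and W: "(gauss_map K has_derivative W) (at x within frontier K)"
  shows "gauss_curvature K x = det (matrix (tangent_extension (gauss_map K x) W))"
proof -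
  define u where "u = gauss_map K x"
  have "norm u = 1"
    using smooth_body_gauss_map_normal[OF K x] outer_unit_normalD(2) by (auto simp: u_def)
  hence u: "u \<bullet> u = 1" by (simp add: dot_square_norm)
  have "W' (v - (v \<bullet> u) *\<^sub>R u) = W (v - (v \<bullet> u) *\<^sub>R u)"
    if "(gauss_map K has_derivative W') (at x within frontier K)" for W' v
    by (rule derivative_frontier_unique_on_tangent[OF K x _ that W])
       (simp add: u_def[symmetric] inner_diff_left u)
  hence ext: "tangent_extension u W' = tangent_extension u W"
    if "(gauss_map K has_derivative W') (at x within frontier K)" for W'
    using that by (simp add: tangent_extension_def fun_eq_iff)
  have "gauss_curvature K x = (THE \<kappa>. \<exists>W. (gauss_map K has_derivative W) (at x within frontier K) \<and>
     \<kappa> = det (matrix (tangent_extension u W)))"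
    by (simp add: gauss_curvature_def Let_def u_def tangent_extension_def[abs_def])
  also have "\<dots> = det (matrix (tangent_extension u W))"
    by (rule the_equality) (use W ext in metis)+
  finally show ?thesis by (simp add: u_def)
qed

text \<open>Otherwise the Gauss map would be constant on a segment, so that its differential would be
  singular in a tangent direction.\<close>
lemma C2_plus_unique_point:
  fixes K :: "(real^'n) set"
  assumes K: "K \<in> C2_plus" and x: "is_outer_unit_normal K x u" and y: "is_outer_unit_normal K y u"
  shows "x = y"
proof (rule ccontr)
  assume "x \<noteq> y"
  have S: "smooth_body K" "closed K" "convex K"
    using K C2_plus_smooth_body by (auto simp: C2_plus_def compact_imp_closed)
  note D = outer_unit_normalD
  have xK: "x \<in> K" "y \<in> K" using D(1)[OF x] D(1)[OF y] S by (auto simp: frontier_def)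
  have eq: "x \<bullet> u = y \<bullet> u" using D(3)[OF x xK(2)] D(3)[OF y xK(1)] by simp
  have gm: "gauss_map K x = u" by (rule smooth_body_gauss_map_eq[OF S(1) x])
  define v where "v = y - x"
  have seg: "is_outer_unit_normal K (x + t *\<^sub>R v) u" if "0 \<le> t" "t \<le> 1" for t
  proof (rule outer_unit_normalI[OF _ D(2)[OF x]])
    have "x + t *\<^sub>R v = (1 - t) *\<^sub>R x + t *\<^sub>R y" by (simp add: v_def algebra_simps)
    then show "x + t *\<^sub>R v \<in> K" using convexD_alt[OF S(3) xK that] by simp
    show "z \<bullet> u \<le> (x + t *\<^sub>R v) \<bullet> u" if "z \<in> K" for z
      using D(3)[OF x that] eq by (simp add: v_def inner_add_left inner_diff_left)
  qed
  obtain W where W: "(gauss_map K has_derivative W) (at x within frontier K)"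
    using C2_plus_gauss_map_differentiable[OF K D(1)[OF x]] by blast
  have linW: "linear W" using W has_derivative_linear by blast
  \<comment> \<open>The segment may leave the frontier before \<open>x\<close>, so it is
    parametrized over \<open>{0..1}\<close> and differentiated at the endpoint 0, where the
    derivative within a closed interval is still unique.\<close>
  have f1: "((\<lambda>t::real. x + t *\<^sub>R v) has_derivative (\<lambda>t. t *\<^sub>R v)) (at 0 within {0..1})"
    by (auto intro!: derivative_eq_intros)
  have "(\<lambda>t. x + t *\<^sub>R v) ` {0..1} \<subseteq> frontier K" using seg D(1) by fastforce
  hence f2: "(gauss_map K has_derivative W) (at (x + 0 *\<^sub>R v) within (\<lambda>t. x + t *\<^sub>R v) ` {0..1})"
    using has_derivative_subset[OF W] by simp
  note has_derivative_in_compose[OF f1 f2]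
  moreover have "((\<lambda>t. gauss_map K (x + t *\<^sub>R v)) has_derivative (\<lambda>t. 0)) (at 0 within {0..1::real})"
    by (rule has_derivative_transform[OF _ _ has_derivative_const[of u]])
       (use smooth_body_gauss_map_eq[OF S(1) seg] in auto)
  ultimately have "(\<lambda>t. W (t *\<^sub>R v)) = (\<lambda>t. 0)"
    using frechet_derivative_unique_within_closed_interval[of "0::real" 1 0] by simp
  hence "W v = 0" by (metis scaleR_one)
  moreover have "v \<bullet> u = 0" using eq by (simp add: v_def inner_diff_left)
  ultimately have "tangent_extension u W v = 0" by (simp add: tangent_extension_def)
  moreover have "tangent_extension u W 0 = 0"
    by (simp add: tangent_extension_def linear_0[OF linW])
  ultimately have "\<not> inj (tangent_extension u W)"
    using \<open>x \<noteq> y\<close> by (metis injD right_minus_eq v_def)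
  hence "det (matrix (tangent_extension u W)) = 0"
    using det_nz_iff_inj[OF linear_tangent_extension[OF linW]] by blast
  hence "gauss_curvature K x = 0"
    using gauss_curvature_eq_det[OF S(1) D(1)[OF x] W] gm by simp
  then show False using K D(1)[OF x] by (auto simp: C2_plus_def)
qed

section \<open>Linear images of convex bodies\<close>

text \<open>The inverse is carried as a parameter, so that every fact about \<open>T\<close> is also
  available for \<open>S\<close> and for the two adjoints by interpretation.\<close>

locale linear_iso =
  fixes T S :: "real^'n \<Rightarrow> real^'n"
  assumes linT: "linear T" and linS: "linear S"
    and TS [simp]: "T (S x) = x" and ST [simp]: "S (T x) = x"
begin

lemma swap: "linear_iso S T"
  by (simp add: linear_iso_def linT linS)

lemma adjoint_inner: "adjoint T x \<bullet> y = x \<bullet> T y"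
  by (metis linT adjoint_works inner_commute)

lemma bij_T: "bij T"
  by (metis TS ST bijI' )

lemma image_image_id [simp]: "T ` S ` K = K" "S ` T ` K = K"
  by (auto simp: image_image)

lemma adjoint_iso: "linear_iso (adjoint T) (adjoint S)"
proof (rule linear_iso.intro)
  show "linear (adjoint T)" "linear (adjoint S)" by (simp_all add: adjoint_linear linT linS)
  have "adjoint T (adjoint S x) \<bullet> y = x \<bullet> y" "adjoint S (adjoint T x) \<bullet> y = x \<bullet> y" for x y
    using adjoint_inner linear_iso.adjoint_inner[OF swap] by simp_all
  then show "adjoint T (adjoint S x) = x" "adjoint S (adjoint T x) = x" for x
    by (metis vector_eq_rdot)+
qed

lemma eq_0_iff [simp]: "T x = 0 \<longleftrightarrow> x = 0"
  by (metis ST linT linS linear_0)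

lemma sgn_sgn [simp]: "x \<noteq> 0 \<Longrightarrow> sgn (T (sgn (S x))) = sgn x"
  using linear_iso.eq_0_iff[OF swap, of x]
  by (simp add: sgn_div_norm linear_scale[OF linT])

lemma frontier_image: "frontier (T ` K) = T ` frontier K"
proof -
  have "closure (T ` K) = T ` closure K" "interior (T ` K) = T ` interior K"
    using closure_injective_linear_image[OF linT bij_is_inj[OF bij_T]]
      interior_bijective_linear_image[OF linT bij_T] by simp_all
  then show ?thesis using bij_is_inj[OF bij_T] by (simp add: frontier_def image_set_diff)
qed

lemma outer_unit_normal_image:
  assumes "is_outer_unit_normal K x u"
  shows "is_outer_unit_normal (T ` K) (T x) (sgn (adjoint S u))"
proof -
  interpret adj: linear_iso "adjoint S" "adjoint T" using linear_iso.swap[OF adjoint_iso] .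
  note D = outer_unit_normalD[OF assms]
  have u: "u \<noteq> 0" using D(2) by auto
  show ?thesis
    unfolding is_outer_unit_normal_def
  proof (intro conjI ballI)
    show "T x \<in> frontier (T ` K)" using D(1) by (simp add: frontier_image)
    show "norm (sgn (adjoint S u)) = 1" using u by (simp add: norm_sgn)
    fix y assume "y \<in> T ` K"
    then obtain z where z: "y = T z" "z \<in> K" by blast
    have "(y - T x) \<bullet> adjoint S u = (z - x) \<bullet> u"
      using linear_iso.adjoint_inner[OF swap, of u "y - T x"]
      by (simp add: z linear_diff[OF linS] inner_commute)
    also have "\<dots> \<le> 0" using D(3)[OF z(2)] by (simp add: inner_diff_left)
    finally show "(y - T x) \<bullet> sgn (adjoint S u) \<le> 0"
      by (simp add: sgn_div_norm mult_le_0_iff)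
  qed
qed

lemma outer_unit_normal_image_iff:
  assumes "norm u = 1"
  shows "is_outer_unit_normal (T ` K) y u \<longleftrightarrow> is_outer_unit_normal K (S y) (sgn (adjoint T u))"
proof
  interpret adj: linear_iso "adjoint S" "adjoint T" using linear_iso.swap[OF adjoint_iso] .
  have u: "sgn u = u" "u \<noteq> 0" using assms by (auto simp: sgn_div_norm)
  show "is_outer_unit_normal K (S y) (sgn (adjoint T u))" if "is_outer_unit_normal (T ` K) y u"
    using linear_iso.outer_unit_normal_image[OF swap that] by simp
  show "is_outer_unit_normal (T ` K) y u" if "is_outer_unit_normal K (S y) (sgn (adjoint T u))"
    using outer_unit_normal_image[OF that] u by simp
qed

lemma smooth_body_image:
  assumes K: "smooth_body K"
  shows "smooth_body (T ` K)"
  unfolding smooth_body_def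
proof
  interpret adj: linear_iso "adjoint S" "adjoint T" using linear_iso.swap[OF adjoint_iso] .
  fix y assume "y \<in> frontier (T ` K)"
  then obtain x where x: "y = T x" "x \<in> frontier K" by (auto simp: frontier_image)
  define u where "u = gauss_map K x"
  have u: "is_outer_unit_normal K x u"
    using smooth_body_gauss_map_normal[OF K x(2)] by (simp add: u_def)
  have "\<exists>d>0. \<forall>t. 0 < t \<and> t < d \<longrightarrow> y + t *\<^sub>R w \<in> T ` K" if w: "w \<bullet> sgn (adjoint S u) < 0" for w
  proof -
    have "w \<bullet> adjoint S u < 0" using w by (auto simp: sgn_div_norm mult_less_0_iff)
    hence "S w \<bullet> gauss_map K x < 0"
      using linear_iso.adjoint_inner[OF swap, of u w] by (simp add: u_def inner_commute)
    then obtain d where d: "d > 0" "\<And>t. 0 < t \<and> t < d \<Longrightarrow> x + t *\<^sub>R S w \<in> K"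
      using smooth_body_inward[OF K x(2)] by blast
    have "y + t *\<^sub>R w = T (x + t *\<^sub>R S w)" for t
      by (simp add: x linear_add[OF linT] linear_scale[OF linT])
    then show ?thesis using d by (metis imageI)
  qed
  then show "\<exists>u. is_outer_unit_normal (T ` K) y u \<and>
      (\<forall>w. w \<bullet> u < 0 \<longrightarrow> (\<exists>d>0. \<forall>t. 0 < t \<and> t < d \<longrightarrow> y + t *\<^sub>R w \<in> T ` K))"
    using outer_unit_normal_image[OF u] x(1) by blast
qed

text \<open>On the frontier of the image, the Gauss map is
  \<open>sgn \<circ> adjoint S \<circ> gauss_map K \<circ> S\<close>. The chain rule with
  \<open>has_derivative_sgn\<close> yields precisely the map \<open>V\<close> of
  \<open>det_tangent_extension_image\<close>.\<close>

lemma gauss_curvature_image: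
  assumes K: "smooth_body K" and x: "x \<in> frontier K"
    and W: "(gauss_map K has_derivative W) (at x within frontier K)"
  shows "gauss_curvature (T ` K) (T x) *
      (norm (adjoint S (gauss_map K x)) ^ (CARD('n) + 1) * (det (matrix T))\<^sup>2) = gauss_curvature K x"
proof -
  interpret adj: linear_iso "adjoint S" "adjoint T" using linear_iso.swap[OF adjoint_iso] .
  note TK = smooth_body_image[OF K]
  define A where "A = adjoint S"
  define u where "u = gauss_map K x"
  define a where "a = norm (A u)"
  define n where "n = A u /\<^sub>R a"
  define V where "V = (\<lambda>v. (A (W (S v)) - (A (W (S v)) \<bullet> n) *\<^sub>R n) /\<^sub>R a)"
  have u1: "norm u = 1" using smooth_body_gauss_map_normal[OF K x] outer_unit_normalD(2) by (auto simp: u_def)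
  hence Au: "A u \<noteq> 0" unfolding A_def by auto
  have nsgn: "n = sgn (A u)" by (simp add: n_def a_def sgn_div_norm)
  have gm: "gauss_map (T ` K) (T z) = sgn (A (gauss_map K z))" if "z \<in> frontier K" for z
    unfolding A_def
    by (rule smooth_body_gauss_map_eq[OF TK outer_unit_normal_image[OF smooth_body_gauss_map_normal[OF K that]]])
  have bS: "bounded_linear S" and bA: "bounded_linear A"
    using linS adj.linT by (simp_all add: A_def linear_conv_bounded_linear)
  have SF: "S ` frontier (T ` K) = frontier K" by (simp add: frontier_image)
  have "((\<lambda>y. gauss_map K (S y)) has_derivative (\<lambda>v. W (S v))) (at (T x) within frontier (T ` K))"
    by (rule has_derivative_in_compose[OF bounded_linear_imp_has_derivative[OF bS]])
       (use W in \<open>simp add: SF\<close>)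
  hence "((\<lambda>y. A (gauss_map K (S y))) has_derivative (\<lambda>v. A (W (S v)))) (at (T x) within frontier (T ` K))"
    by (rule bounded_linear.has_derivative[OF bA])
  hence "((\<lambda>y. sgn (A (gauss_map K (S y)))) has_derivative V) (at (T x) within frontier (T ` K))"
    using has_derivative_compose[OF _ has_derivative_sgn, of "\<lambda>y. A (gauss_map K (S y))" "\<lambda>v. A (W (S v))" "T x"] Au
    by (simp add: V_def nsgn a_def u_def)
  hence V: "(gauss_map (T ` K) has_derivative V) (at (T x) within frontier (T ` K))"
    by (rule has_derivative_transform[rotated 2]) (use x gm in \<open>auto simp: frontier_image\<close>)
  have Tx: "T x \<in> frontier (T ` K)" using x by (simp add: frontier_image)
  have "det (matrix (tangent_extension n V)) * (a ^ (CARD('n) + 1) * (det (matrix T))\<^sup>2)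
         = det (matrix (tangent_extension u W))"
    unfolding V_def n_def a_def A_def
    by (rule det_tangent_extension_image) (use has_derivative_linear[OF W] linT linS u1 in \<open>auto simp: o_def\<close>)
  then show ?thesis
    unfolding gauss_curvature_eq_det[OF TK Tx V] gauss_curvature_eq_det[OF K x W] gm[OF x]
    by (simp add: nsgn a_def u_def A_def)
qed

lemma det_T: "det (matrix T) \<noteq> 0"
  using det_nz_iff_inj[OF linT] bij_is_inj[OF bij_T] by blast

end

section \<open>Support and curvature functions of a body and of its linear images\<close>

lemma support_function_eq_inner:
  assumes "closed K" "is_outer_unit_normal K x u"
  shows "support_function K u = x \<bullet> u"
proof -
  have "x \<in> K" using assms(1) outer_unit_normalD(1)[OF assms(2)] by (simp add: frontier_def)
  then show ?thesis unfolding support_function_def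
    using outer_unit_normalD(3)[OF assms(2)] by (intro cSup_eq_maximum) auto
qed

lemma C2_plus_ex1_point:
  fixes K :: "(real^'n) set"
  assumes "K \<in> C2_plus" "norm u = 1"
  shows "\<exists>!x. is_outer_unit_normal K x u"
  using ex_point_with_outer_unit_normal[of K u] C2_plus_unique_point[OF assms(1)] assms interior_subset
  by (fastforce simp: C2_plus_def)

lemma C2_plus_support_function_pos:
  assumes "K \<in> C2_plus" "norm u = 1"
  shows "support_function K u > 0"
proof -
  obtain x where x: "is_outer_unit_normal K x u" using C2_plus_ex1_point[OF assms] by blast
  have K: "closed K" "0 \<in> interior K" using assms by (auto simp: C2_plus_def compact_imp_closed)
  obtain e where e: "e > 0" "cball 0 e \<subseteq> K" using K(2) by (meson mem_interior_cball)
  have "e *\<^sub>R u \<in> K" using e assms by auto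
  from outer_unit_normalD(3)[OF x this] have "e \<le> x \<bullet> u"
    using assms(2) by (simp add: dot_square_norm)
  then show ?thesis using e support_function_eq_inner[OF K(1) x] by simp
qed

lemma C2_plus_curvature_function_pos:
  assumes "K \<in> C2_plus" "norm u = 1"
  shows "curvature_function K u > 0"
proof -
  have "is_outer_unit_normal K (THE x. is_outer_unit_normal K x u) u"
    by (rule theI'[OF C2_plus_ex1_point[OF assms]])
  then show ?thesis
    using assms(1) outer_unit_normalD(1) by (auto simp: curvature_function_def C2_plus_def)
qed

context linear_iso
begin

text \<open>The image has normal \<open>u\<close> only at \<open>T x\<close>, where \<open>x\<close>
  is the point of \<open>K\<close> with normal \<open>v\<close>, the normalization of
  \<open>adjoint T u\<close>. Both formulas are then evaluations at this pair of points.\<close>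

lemma
  assumes K: "K \<in> C2_plus" and u: "norm u = 1"
  shows support_function_image:
      "support_function (T ` K) u = norm (adjoint T u) * support_function K (sgn (adjoint T u))"
    and curvature_function_image:
      "curvature_function (T ` K) u =
        (det (matrix T))\<^sup>2 / norm (adjoint T u) ^ (CARD('n) + 1) * curvature_function K (sgn (adjoint T u))"
proof -
  interpret adj: linear_iso "adjoint T" "adjoint S" using adjoint_iso .
  define v where "v = sgn (adjoint T u)"
  define b where "b = norm (adjoint T u)"
  have Tu: "adjoint T u \<noteq> 0" using u by auto
  hence b: "b > 0" by (simp add: b_def)
  have v1: "norm v = 1" using Tu by (simp add: v_def norm_sgn)
  have bv: "adjoint T u = b *\<^sub>R v" using b by (simp add: b_def v_def sgn_div_norm)
  have S: "smooth_body K" "closed K"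
    using K C2_plus_smooth_body by (auto simp: C2_plus_def compact_imp_closed)
  have "compact (T ` K)"
    using K linear_continuous_on[of T K] linear_conv_bounded_linear[of T] linT
    by (auto simp: C2_plus_def intro: compact_continuous_image)
  hence cl: "closed (T ` K)" by (rule compact_imp_closed)
  define x where "x = (THE x. is_outer_unit_normal K x v)"
  have x: "is_outer_unit_normal K x v"
    unfolding x_def by (rule theI'[OF C2_plus_ex1_point[OF K v1]])
  have iff: "is_outer_unit_normal (T ` K) y u \<longleftrightarrow> y = T x" for y
    using outer_unit_normal_image_iff[OF u, of K y] x C2_plus_unique_point[OF K x] unfolding v_def[symmetric]
    by (metis TS ST)
  have "support_function (T ` K) u = T x \<bullet> u"
    using support_function_eq_inner[OF cl] iff by simp
  also have "\<dots> = x \<bullet> (b *\<^sub>R v)" using adjoint_inner[of u x] by (simp add: bv inner_commute)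
  also have "\<dots> = b * support_function K v" using support_function_eq_inner[OF S(2) x] by simp
  finally show "support_function (T ` K) u = norm (adjoint T u) * support_function K (sgn (adjoint T u))"
    by (simp add: b_def v_def)
  have xf: "x \<in> frontier K" using outer_unit_normalD(1)[OF x] .
  obtain W where W: "(gauss_map K has_derivative W) (at x within frontier K)"
    using C2_plus_gauss_map_differentiable[OF K xf] by blast
  have gm: "gauss_map K x = v" by (rule smooth_body_gauss_map_eq[OF S(1) x])
  \<comment> \<open>\<open>gauss_curvature_image\<close> involves the norm of
    \<open>adjoint S v\<close>. Since \<open>adjoint S\<close> inverts \<open>adjoint T\<close>,
    this norm is the reciprocal of \<open>b\<close>.\<close>
  have "b *\<^sub>R adjoint S v = u"
    using adj.ST[of u] by (simp add: bv linear_scale[OF adj.linS])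
  hence "b * norm (adjoint S v) = 1" using u b by (metis abs_of_pos norm_scaleR)
  hence nS: "norm (adjoint S v) = 1 / b" using b by (simp add: field_simps)
  have "gauss_curvature (T ` K) (T x) * ((1 / b) ^ (CARD('n) + 1) * (det (matrix T))\<^sup>2) = gauss_curvature K x"
    using gauss_curvature_image[OF S(1) xf W] by (simp add: gm nS)
  moreover have "gauss_curvature K x > 0" using K xf by (auto simp: C2_plus_def)
  moreover from calculation have "gauss_curvature (T ` K) (T x) \<noteq> 0" by auto
  ultimately have "1 / gauss_curvature (T ` K) (T x) = (det (matrix T))\<^sup>2 / b ^ (CARD('n) + 1) * (1 / gauss_curvature K x)"
    using b by (auto simp: field_simps)
  then show "curvature_function (T ` K) u =
        (det (matrix T))\<^sup>2 / norm (adjoint T u) ^ (CARD('n) + 1) * curvature_function K (sgn (adjoint T u))"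
    by (simp add: curvature_function_def iff b_def v_def[symmetric] x_def[symmetric])
qed

end

section \<open>Linear substitutions in the spherical measure\<close>

lemma nn_integral_lborel_split:
  fixes h :: "'a::euclidean_space \<Rightarrow> ennreal"
  assumes b: "b \<in> Basis" and [measurable]: "h \<in> borel_measurable borel"
  shows "(\<integral>\<^sup>+x. h x \<partial>lborel) = (\<integral>\<^sup>+x. (\<integral>\<^sup>+y. h ((\<Sum>c\<in>Basis - {b}. x c *\<^sub>R c) + y *\<^sub>R b) \<partial>lborel)
            \<partial>(\<Pi>\<^sub>M c\<in>Basis - {b}. lborel))"
proof -
  interpret product_sigma_finite "\<lambda>_::'a. lborel :: real measure" by standard
  define f where "f = (\<lambda>x::'a \<Rightarrow> real. h (\<Sum>c\<in>Basis. x c *\<^sub>R c))"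
  have ins: "insert b (Basis - {b}) = Basis" using b by auto
  have f: "f \<in> borel_measurable (\<Pi>\<^sub>M c\<in>insert b (Basis - {b}). lborel)"
    unfolding f_def ins by measurable
  have "(\<integral>\<^sup>+x. h x \<partial>lborel) = (\<integral>\<^sup>+x. f x \<partial>(\<Pi>\<^sub>M c\<in>insert b (Basis - {b}). lborel))"
    unfolding ins by (subst lborel_eq) (simp add: nn_integral_distr f_def)
  also have "\<dots> = (\<integral>\<^sup>+x. (\<integral>\<^sup>+y. f (x(b := y)) \<partial>lborel) \<partial>(\<Pi>\<^sub>M c\<in>Basis - {b}. lborel))"
    by (rule product_nn_integral_insert) (use f in auto)
  also have "(\<lambda>x y. f (x(b := y))) = (\<lambda>x y. h ((\<Sum>c\<in>Basis - {b}. x c *\<^sub>R c) + y *\<^sub>R b))"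
    using b by (simp add: f_def sum.remove add.commute fun_eq_iff)
  finally show ?thesis .
qed

text \<open>\<open>k\<close> is constant on each line in direction \<open>b\<close>, so on such a
  line the shear is a translation; Fubini in that one coordinate reduces the claim to translation
  invariance on the reals.\<close>

lemma nn_integral_lborel_shear:
  fixes h :: "'a::euclidean_space \<Rightarrow> ennreal"
  assumes b: "b \<in> Basis" and h [measurable]: "h \<in> borel_measurable borel"
    and k [measurable]: "k \<in> borel_measurable borel" and inv: "\<And>x t. k (x + t *\<^sub>R b) = k x"
  shows "(\<integral>\<^sup>+x. h (x + k x *\<^sub>R b) \<partial>lborel) = (\<integral>\<^sup>+x. h x \<partial>lborel)"
proof -
  have "(\<integral>\<^sup>+y. h ((z + y *\<^sub>R b) + k (z + y *\<^sub>R b) *\<^sub>R b) \<partial>lborel) = (\<integral>\<^sup>+y. h (z + y *\<^sub>R b) \<partial>lborel)" for z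
    using nn_integral_real_affine[of "\<lambda>y. h (z + y *\<^sub>R b)" 1 "k z"]
    by (simp add: inv algebra_simps)
  then show ?thesis
    by (simp add: nn_integral_lborel_split[OF b])
qed

text \<open>The library's theorems on linear images of Lebesgue measure require a well-ordered index type.\<close>
lemma nn_integral_linear_substitution:
  fixes f :: "real^'n \<Rightarrow> real^'n"
  assumes lin: "linear f" and det: "det (matrix f) \<noteq> 0" and h: "h \<in> borel_measurable borel"
  shows "(\<integral>\<^sup>+x. h x \<partial>lborel) = ennreal \<bar>det (matrix f)\<bar> * (\<integral>\<^sup>+x. h (f x) \<partial>lborel)"
proof -
  \<comment> \<open>The integrand is quantified inside \<open>P\<close>, because a composition
    applies the formula for one factor to \<open>h\<close> composed with the other. Singular maps
    satisfy \<open>P\<close> by linearity alone, which disposes of the generators with a vanishing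
    coordinate.\<close>
  define P where "P = (\<lambda>f::real^'n \<Rightarrow> real^'n. linear f \<and> (det (matrix f) \<noteq> 0 \<longrightarrow>
     (\<forall>h\<in>borel_measurable borel. (\<integral>\<^sup>+x. h x \<partial>lborel) = ennreal \<bar>det (matrix f)\<bar> * (\<integral>\<^sup>+x. h (f x) \<partial>lborel))))"
  have meas: "f \<in> borel_measurable borel" if "linear f" for f :: "real^'n \<Rightarrow> real^'n"
    using that by (intro borel_measurable_continuous_onI linear_continuous_on) (simp add: linear_conv_bounded_linear)
  have PD: "(\<integral>\<^sup>+x. h x \<partial>lborel) = ennreal \<bar>det (matrix f)\<bar> * (\<integral>\<^sup>+x. h (f x) \<partial>lborel)"
    if "P f" "det (matrix f) \<noteq> 0" "h \<in> borel_measurable borel" for f h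
    using that unfolding P_def by blast
  have comp: "P (f \<circ> g)" if "P f" "P g" for f g
  proof -
    have [measurable]: "f \<in> borel_measurable borel" "g \<in> borel_measurable borel"
      using that meas by (auto simp: P_def)
    have d: "det (matrix (f \<circ> g)) = det (matrix f) * det (matrix g)"
      using that by (auto simp: P_def det_matrix_compose)
    show ?thesis
      unfolding P_def
    proof (intro conjI impI ballI)
      show "linear (f \<circ> g)" using that by (auto simp: P_def linear_compose)
      fix h :: "real^'n \<Rightarrow> ennreal" assume [measurable]: "h \<in> borel_measurable borel"
      assume "det (matrix (f \<circ> g)) \<noteq> 0"
      hence nz: "det (matrix f) \<noteq> 0" "det (matrix g) \<noteq> 0" by (auto simp: d)
      have "(\<integral>\<^sup>+x. h x \<partial>lborel) = ennreal \<bar>det (matrix f)\<bar> * (\<integral>\<^sup>+x. h (f x) \<partial>lborel)"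
        using PD[OF that(1) nz(1), of h] by simp
      also have "(\<integral>\<^sup>+x. h (f x) \<partial>lborel) = ennreal \<bar>det (matrix g)\<bar> * (\<integral>\<^sup>+x. h (f (g x)) \<partial>lborel)"
        using PD[OF that(2) nz(2), of "\<lambda>x. h (f x)"] by simp
      finally show "(\<integral>\<^sup>+x. h x \<partial>lborel) = ennreal \<bar>det (matrix (f \<circ> g))\<bar> * (\<integral>\<^sup>+x. h ((f \<circ> g) x) \<partial>lborel)"
        by (simp add: d abs_mult ennreal_mult mult.assoc)
    qed
  qed
  have zeroes: "P f" if "linear f" "\<And>x. f x $ i = 0" for f and i :: 'n
  proof -
    have "\<not> surj f"
      using that(2)[of "inv f (axis i 1)"] by (metis axis_nth surj_f_inv_f zero_neq_one)
    hence "det (matrix f) = 0"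
      using det_nz_iff_inj[OF that(1)] linear_injective_imp_surjective[OF that(1)] by blast
    then show ?thesis using that(1) by (simp add: P_def)
  qed
  have scaling: "P (\<lambda>x. \<chi> i. c i * x $ i)" for c
  proof (cases "\<exists>i. c i = 0")
    case True
    then show ?thesis
      by (auto intro!: zeroes linearI simp: vec_eq_iff algebra_simps)
  next
    case False
    \<comment> \<open>The diagonal map written as a sum over \<open>Basis\<close>, the form in which
      \<open>lborel_affine_euclidean\<close> describes it.\<close>
    define T where "T = (\<lambda>x::real^'n. \<Sum>j\<in>Basis. (c (axis_index j) * (x \<bullet> j)) *\<^sub>R j)"
    have T: "T = (\<lambda>x. \<chi> i. c i * x $ i)"
    proof
      fix x
      have "T x \<bullet> axis i 1 = c i * (x \<bullet> axis i 1)" for i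
        unfolding T_def by (subst inner_sum_left_Basis) auto
      then show "T x = (\<chi> i. c i * x $ i)" by (simp add: vec_eq_iff inner_axis)
    qed
    have "(\<Prod>j\<in>Basis. \<bar>c (axis_index (j::real^'n))\<bar>) = (\<Prod>i\<in>UNIV. \<bar>c i\<bar>)"
      by (rule prod.reindex_bij_witness[where i = "\<lambda>i. axis i 1" and j = axis_index])
         (auto simp: Basis_vec_def axis_index_axis)
    moreover have "\<bar>det (matrix (\<lambda>x. \<chi> i. c i * x $ i))\<bar> = (\<Prod>i\<in>UNIV. \<bar>c i\<bar>)"
      by (subst det_diagonal) (auto simp: matrix_def axis_def abs_prod)
    ultimately have detT: "(\<Prod>j\<in>Basis. \<bar>c (axis_index (j::real^'n))\<bar>) = \<bar>det (matrix T)\<bar>"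
      by (simp add: T)
    have "lborel = density (distr lborel borel T) (\<lambda>_. ennreal (\<Prod>j\<in>Basis. \<bar>c (axis_index (j::real^'n))\<bar>))"
      using lborel_affine_euclidean[of "\<lambda>j. c (axis_index j)" "0::real^'n"] False by (simp add: T_def)
    hence lb: "lborel = density (distr lborel borel T) (\<lambda>_. ennreal \<bar>det (matrix T)\<bar>)"
      unfolding detT .
    have linT: "linear T" unfolding T
      by (auto intro!: linearI simp: vec_eq_iff algebra_simps)
    note [measurable] = meas[OF linT]
    have "P T" unfolding P_def
    proof (intro conjI impI ballI linT)
      fix h :: "real^'n \<Rightarrow> ennreal" assume [measurable]: "h \<in> borel_measurable borel"
      have "(\<integral>\<^sup>+x. h x \<partial>lborel) = (\<integral>\<^sup>+x. h x \<partial>density (distr lborel borel T) (\<lambda>_. ennreal \<bar>det (matrix T)\<bar>))"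
        using arg_cong[OF lb, of "\<lambda>M. \<integral>\<^sup>+x. h x \<partial>M"] .
      then show "(\<integral>\<^sup>+x. h x \<partial>lborel) = ennreal \<bar>det (matrix T)\<bar> * (\<integral>\<^sup>+x. h (T x) \<partial>lborel)"
        by (simp add: nn_integral_density nn_integral_distr nn_integral_cmult)
    qed
    then show ?thesis by (simp add: T)
  qed
  have shear: "P (\<lambda>x. \<chi> i. if i = m then x $ m + c * x $ n else x $ i)" if mn: "m \<noteq> n" for m n :: 'n and c
  proof -
    define E where "E = (\<lambda>x::real^'n. x + (c * x $ n) *\<^sub>R axis m 1)"
    have E: "E = (\<lambda>x. \<chi> i. if i = m then x $ m + c * x $ n else x $ i)"
      by (auto simp: E_def vec_eq_iff axis_def)
    have axis_component: "axis m (1::real) $ n = 0" using mn by (simp add: axis_def)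
    have lin: "linear (\<lambda>x::real^'n. c * x $ n)"
      by (auto intro!: linearI simp: algebra_simps)
    have "det (matrix E) = 1"
      unfolding E_def using det_id_plus_rank_one[OF lin, of "axis m 1"] mn by (simp add: axis_def)
    moreover have "linear E"
      by (auto intro!: linearI simp: E_def algebra_simps)
    moreover have "(\<integral>\<^sup>+x. h (E x) \<partial>lborel) = (\<integral>\<^sup>+x. h x \<partial>lborel)" if "h \<in> borel_measurable borel" for h
      unfolding E_def
      by (rule nn_integral_lborel_shear)
         (use mn that in \<open>auto simp: axis_component\<close>)
    ultimately show ?thesis by (simp add: P_def flip: E)
  qed
  have "P f"
  proof (rule induct_linear_elementary[OF lin])
    fix m n :: 'n assume mn: "m \<noteq> n"
    show "P (\<lambda>x. \<chi> i. if i = m then x $ m + x $ n else x $ i)"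
      using shear[OF mn, of 1] unfolding mult_1 .
    \<comment> \<open>A swap of two coordinates is three shears and a sign change: (a, b) becomes (a
      + b, b), (a + b, -a), (b, -a) and finally (b, a).\<close>
    let ?E = "\<lambda>x. \<chi> i. if i = m then x $ m + 1 * x $ n else x $ i"
    let ?F = "\<lambda>x. \<chi> i. if i = n then x $ n + (-1) * x $ m else x $ i"
    let ?D = "\<lambda>x. \<chi> i. (if i = n then -1 else 1) * x $ i"
    have "(\<lambda>x::real^'n. \<chi> i. x $ Transposition.transpose m n i) = ?D \<circ> (?E \<circ> (?F \<circ> ?E))"
      using mn by (auto simp: fun_eq_iff vec_eq_iff Transposition.transpose_def)
    moreover have "P (?D \<circ> (?E \<circ> (?F \<circ> ?E)))"
      by (intro comp scaling shear mn mn[symmetric])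
    ultimately show "P (\<lambda>x. \<chi> i. x $ Transposition.transpose m n i)" by simp
  qed (blast intro: comp zeroes | rule scaling)+
  then show ?thesis using PD det h by blast
qed

section \<open>Exchanging the unit ball for a star-shaped body\<close>

lemma nn_integral_lborel_scale:
  fixes f :: "'a::euclidean_space \<Rightarrow> ennreal"
  assumes [measurable]: "f \<in> borel_measurable borel" and "c > 0"
  shows "(\<integral>\<^sup>+x. f x \<partial>lborel) = (\<integral>\<^sup>+x. ennreal (c ^ DIM('a)) * f (c *\<^sub>R x) \<partial>lborel)"
  using \<open>c > 0\<close>
  by (subst lborel_affine[of c 0])
     (simp_all add: nn_integral_density nn_integral_distr)

lemma nn_integral_power_Ioo:
  fixes q :: real
  assumes "q > 0" "n > 0"
  shows "(\<integral>\<^sup>+s. ennreal (real n * q ^ n * s ^ (n - 1)) * indicator {0<..<1/q} s \<partial>lborel) = 1"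
proof -
  have "(\<integral>\<^sup>+s. ennreal (real n * q ^ n * s ^ (n - 1)) * indicator {0<..<1/q} s \<partial>lborel)
      = (\<integral>\<^sup>+s. ennreal (real n * q ^ n * s ^ (n - 1)) * indicator {0..1/q} s \<partial>lborel)"
  proof (rule nn_integral_cong_AE)
    show "AE s in lborel. ennreal (real n * q ^ n * s ^ (n - 1)) * indicator {0<..<1/q} s
       = ennreal (real n * q ^ n * s ^ (n - 1)) * indicator {0..1/q} s"
      using AE_lborel_singleton[of 0] AE_lborel_singleton[of "1/q"]
      by eventually_elim (auto simp: indicator_def)
  qed
  also have "\<dots> = q ^ n * (1/q) ^ n - q ^ n * 0 ^ n"
    by (rule nn_integral_FTC_Icc[where F = "\<lambda>s. q ^ n * s ^ n"])
       (use assms in \<open>auto intro!: derivative_eq_intros\<close>)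
  also have "\<dots> = 1" using assms by (simp add: power_divide)
  finally show ?thesis .
qed

lemma nn_integral_inverse_power_Ioi:
  fixes r :: real
  assumes "r > 0" "n > 0"
  shows "(\<integral>\<^sup>+s. ennreal (real n * inverse s ^ (n + 1)) * indicator {r<..} s \<partial>lborel) = ennreal (inverse r ^ n)"
proof -
  have "(\<integral>\<^sup>+s. ennreal (real n * inverse s ^ (n + 1)) * indicator {r<..} s \<partial>lborel)
      = (\<integral>\<^sup>+s. ennreal (real n * inverse s ^ (n + 1)) * indicator {r..} s \<partial>lborel)"
  proof (rule nn_integral_cong_AE)
    show "AE s in lborel. ennreal (real n * inverse s ^ (n + 1)) * indicator {r<..} s
       = ennreal (real n * inverse s ^ (n + 1)) * indicator {r..} s"
      using AE_lborel_singleton[of r] by eventually_elim (auto simp: indicator_def)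
  qed
  also have "\<dots> = ennreal (0 - (- (inverse r ^ n)))"
  proof (rule nn_integral_FTC_atLeast)
    fix s assume "r \<le> s"
    hence s: "s > 0" using assms by simp
    obtain m where m: "n = Suc m" using assms gr0_implies_Suc by blast
    show "DERIV (\<lambda>s. - (inverse s ^ n)) s :> real n * inverse s ^ (n + 1)"
      using DERIV_minus[OF DERIV_power_Suc[OF DERIV_inverse[of s], of m]] s
      by (simp add: m algebra_simps)
    show "0 \<le> real n * inverse s ^ (n + 1)" using s by simp
  next
    have "((\<lambda>s::real. - (inverse s ^ n)) \<longlongrightarrow> - (0 ^ n)) at_top"
      by (intro tendsto_intros tendsto_inverse_0_at_top filterlim_ident)
    moreover have "- (0 ^ n) = (0::real)" using assms by simp
    ultimately show "((\<lambda>s::real. - (inverse s ^ n)) \<longlongrightarrow> 0) at_top" by (simp only:)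
  qed measurable
  finally show ?thesis by simp
qed

text \<open>Insert \<open>1 = \<integral>\<^sub>0\<^sup>1\<^sup>/\<^sup>q n q\<^sup>n s\<^sup>n\<^sup>-\<^sup>1 ds\<close>, replace \<open>y\<close> by \<open>y / s\<close>, and integrate over \<open>s\<close> first:
  polar coordinates are not needed.\<close>
lemma nn_integral_star_body_exchange:
  fixes G :: "real^'n \<Rightarrow> ennreal" and q :: "real^'n \<Rightarrow> real"
  assumes [measurable]: "G \<in> borel_measurable borel" "q \<in> borel_measurable borel"
    and G: "\<And>s y. s > 0 \<Longrightarrow> G (s *\<^sub>R y) = G y"
    and q: "\<And>s y. s > 0 \<Longrightarrow> q (s *\<^sub>R y) = s * q y"
    and q_pos: "\<And>y. y \<noteq> 0 \<Longrightarrow> q y > 0"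
  shows "(\<integral>\<^sup>+y. G y * indicator (ball 0 1 - {0}) y \<partial>lborel)
       = (\<integral>\<^sup>+y. G y * ennreal ((q y / norm y) ^ CARD('n)) * indicator ({y. q y < 1} - {0}) y \<partial>lborel)"
proof -
  define n where "n = CARD('n)"
  have n: "n > 0" by (simp add: n_def)
  \<comment> \<open>Integrating \<open>F\<close> over \<open>s\<close> gives back the integrand on
    the ball, since the factor in \<open>s\<close> has integral 1 over
    \<open>(0, 1 / q y)\<close>.\<close>
  define F where "F = (\<lambda>(s, y). if y \<noteq> 0 \<and> norm y < 1 \<and> 0 < s \<and> s * q y < 1
     then G y * ennreal (real n * q y ^ n * s ^ (n - 1)) else 0)"
  \<comment> \<open>\<open>F\<close> after replacing \<open>y\<close> by \<open>y / s\<close>,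
    Jacobian included: \<open>s^(-n) * s^(-n) * s^(n-1) = s^(-(n+1))\<close>. The two constraints
    trade places: \<open>s * q y < 1\<close> becomes \<open>q y < 1\<close>, and
    \<open>norm y < 1\<close> becomes \<open>norm y < s\<close>, so integrating over
    \<open>s\<close> now produces \<open>norm y^(-n)\<close>.\<close>
  define F' where "F' = (\<lambda>(s, y). if y \<noteq> 0 \<and> q y < 1 \<and> norm y < s
     then G y * ennreal (q y ^ n) * ennreal (real n * inverse s ^ (n + 1)) else 0)"
  have [measurable]: "F \<in> borel_measurable (lborel \<Otimes>\<^sub>M lborel)"
    "F' \<in> borel_measurable (lborel \<Otimes>\<^sub>M lborel)"
    unfolding F_def F'_def by (measurable)
  have "(\<integral>\<^sup>+s. F (s, y) \<partial>lborel) = G y * indicator (ball 0 1 - {0}) y" for y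
  proof (cases "y = 0")
    case False
    have "F (s, y) = (G y * indicator (ball 0 1 - {0}) y) *
        (ennreal (real n * q y ^ n * s ^ (n - 1)) * indicator {0<..<1 / q y} s)" for s
      using q_pos[OF False] False by (auto simp: F_def field_simps split: split_indicator)
    then show ?thesis
      using nn_integral_power_Ioo[OF q_pos[OF False] n] by (simp add: nn_integral_cmult)
  qed (simp add: F_def)
  hence "(\<integral>\<^sup>+y. G y * indicator (ball 0 1 - {0}) y \<partial>lborel)
      = (\<integral>\<^sup>+y. (\<integral>\<^sup>+s. F (s, y) \<partial>lborel) \<partial>lborel)" by simp
  also have "\<dots> = (\<integral>\<^sup>+s. (\<integral>\<^sup>+y. F (s, y) \<partial>lborel) \<partial>lborel)"
    by (rule lborel_pair.Fubini') measurable
  also have "\<dots> = (\<integral>\<^sup>+s. (\<integral>\<^sup>+y. F' (s, y) \<partial>lborel) \<partial>lborel)"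
  proof (rule nn_integral_cong)
    fix s :: real
    show "(\<integral>\<^sup>+y. F (s, y) \<partial>lborel) = (\<integral>\<^sup>+y. F' (s, y) \<partial>lborel)"
    proof (cases "s > 0")
      case s: True
      have "(\<integral>\<^sup>+y. F (s, y) \<partial>lborel) = (\<integral>\<^sup>+y. ennreal (inverse s ^ n) * F (s, inverse s *\<^sub>R y) \<partial>lborel)"
        using nn_integral_lborel_scale[of "\<lambda>y. F (s, y)" "inverse s"] s by (simp add: n_def)
      also have "\<dots> = (\<integral>\<^sup>+y. F' (s, y) \<partial>lborel)"
      proof (rule nn_integral_cong)
        fix y :: "real^'n"
        have qs: "q (inverse s *\<^sub>R y) = inverse s * q y" and Gs: "G (inverse s *\<^sub>R y) = G y"
          using q[of "inverse s" y] G[of "inverse s" y] s by auto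
        have qs2: "s * q (inverse s *\<^sub>R y) = q y" using s by (simp add: qs)
        have nl: "norm (inverse s *\<^sub>R y) < 1 \<longleftrightarrow> norm y < s" using s by (simp add: field_simps)
        show "ennreal (inverse s ^ n) * F (s, inverse s *\<^sub>R y) = F' (s, y)"
        proof (cases "y \<noteq> 0 \<and> norm y < s \<and> q y < 1")
          case True
          obtain m where m: "n = Suc m" using n gr0_implies_Suc by blast
          have "inverse s ^ n * (real n * (inverse s * q y) ^ n * s ^ (n - 1)) = q y ^ n * (real n * inverse s ^ (n + 1))"
            using s by (simp add: m field_simps)
          then have "ennreal (inverse s ^ n) * ennreal (real n * (inverse s * q y) ^ n * s ^ (n - 1))
             = ennreal (q y ^ n) * ennreal (real n * inverse s ^ (n + 1))"
            using s q_pos[of y] True by (simp flip: ennreal_mult)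
          moreover have "norm (inverse s *\<^sub>R y) < 1" "s * q (inverse s *\<^sub>R y) < 1"
            using True by (simp_all only: nl qs2)
          ultimately show ?thesis
            using True s unfolding F_def F'_def by (simp add: qs Gs) (simp only: mult_ac)
        next
          case False
          hence "F (s, inverse s *\<^sub>R y) = 0" "F' (s, y) = 0"
            using s qs2 nl by (auto simp: F_def F'_def simp del: norm_scaleR)
          then show ?thesis by simp
        qed
      qed
      finally show ?thesis .
    next
      case False
      hence "F (s, y) = 0" "F' (s, y) = 0" for y
        using norm_ge_zero[of y] by (auto simp: F_def F'_def simp del: norm_ge_zero)
      then show ?thesis by simp
    qed
  qed
  also have "\<dots> = (\<integral>\<^sup>+y. (\<integral>\<^sup>+s. F' (s, y) \<partial>lborel) \<partial>lborel)"
    by (rule lborel_pair.Fubini'[symmetric]) measurable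
  also have "\<dots> = (\<integral>\<^sup>+y. G y * ennreal ((q y / norm y) ^ n) * indicator ({y. q y < 1} - {0}) y \<partial>lborel)"
  proof (rule nn_integral_cong)
    fix y :: "real^'n"
    show "(\<integral>\<^sup>+s. F' (s, y) \<partial>lborel) = G y * ennreal ((q y / norm y) ^ n) * indicator ({y. q y < 1} - {0}) y"
    proof (cases "y = 0")
      case False
      have "F' (s, y) = G y * ennreal (q y ^ n) * indicator ({y. q y < 1} - {0}) y *
          (ennreal (real n * inverse s ^ (n + 1)) * indicator {norm y<..} s)" for s
        using False by (auto simp: F'_def split: split_indicator)
      hence "(\<integral>\<^sup>+s. F' (s, y) \<partial>lborel) = G y * ennreal (q y ^ n) * indicator ({y. q y < 1} - {0}) y * ennreal (inverse (norm y) ^ n)"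
        using nn_integral_inverse_power_Ioi[of "norm y" n] n False
        by (simp add: nn_integral_cmult)
      also have "\<dots> = G y * (ennreal (q y ^ n) * ennreal (inverse (norm y) ^ n)) * indicator ({y. q y < 1} - {0}) y"
        by (simp only: mult_ac)
      also have "ennreal (q y ^ n) * ennreal (inverse (norm y) ^ n) = ennreal ((q y / norm y) ^ n)"
        using q_pos[OF False] by (simp add: divide_inverse power_mult_distrib flip: ennreal_mult)
      finally show ?thesis .
    qed (simp add: F'_def)
  qed
  finally show ?thesis by (simp add: n_def)
qed

section \<open>The action of a linear map on the spherical measure\<close>

lemma sets_sphere_measure: "sets (sphere_measure :: (real^'n) measure) = sets (restrict_space borel (sphere 0 1))"
  by (simp add: sphere_measure_def)

lemma measurable_sphere_measure:
  "measurable (sphere_measure :: (real^'n) measure) N = measurable (restrict_space borel (sphere 0 1)) N"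
  by (rule measurable_cong_sets[OF sets_sphere_measure refl])

lemma nn_integral_sphere_measure:
  fixes g :: "real^'n \<Rightarrow> ennreal"
  assumes g: "g \<in> borel_measurable (restrict_space borel (sphere 0 1))"
  shows "(\<integral>\<^sup>+u. g u \<partial>sphere_measure)
       = of_nat CARD('n) * (\<integral>\<^sup>+x. g (sgn x) * indicator (ball 0 1 - {0}) x \<partial>lborel)"
proof -
  have "(\<lambda>x::real^'n. x /\<^sub>R norm x) \<in> restrict_space lborel (ball 0 1 - {0}) \<rightarrow>\<^sub>M restrict_space borel (sphere 0 1)"
    by (intro measurable_restrict_space2 measurable_restrict_space1)
       (auto simp: space_restrict_space)
  then show ?thesis
    unfolding sphere_measure_def using g
    by (simp add: nn_integral_scale_measure nn_integral_distr nn_integral_restrict_space sgn_div_norm)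
qed

context linear_iso
begin

lemma measurable_T [measurable]: "T \<in> borel_measurable borel"
  using linT by (intro borel_measurable_continuous_onI linear_continuous_on) (simp add: linear_conv_bounded_linear)

abbreviation (input) sphere_borel :: "(real^'n) measure" where
  "sphere_borel \<equiv> restrict_space borel (sphere 0 1)"

lemma measurable_sgn_T [measurable]:
  "(\<lambda>u. sgn (T u)) \<in> sphere_borel \<rightarrow>\<^sub>M sphere_borel"
proof (rule measurable_restrict_space2)
  show "(\<lambda>u. sgn (T u)) \<in> space sphere_borel \<rightarrow> sphere 0 1"
    by (auto simp: space_restrict_space norm_sgn)
  have "(\<lambda>u. sgn (T u)) \<in> borel_measurable borel"
    unfolding sgn_div_norm by measurable
  then show "(\<lambda>u. sgn (T u)) \<in> borel_measurable sphere_borel"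
    by (rule measurable_restrict_space1)
qed

text \<open>As an integral over the ball, the left side has the integrand
  \<open>(norm x / norm (T x))^n\<close> times an indicator of the direction of \<open>T x\<close>.
  Substituting \<open>y = T x\<close> moves it to the ellipsoid \<open>norm (S y) < 1\<close>, and
  \<open>nn_integral_star_body_exchange\<close> with \<open>q y = norm (S y)\<close> absorbs the
  power and returns to the ball.\<close>

lemma distr_density_sphere_measure:
  "distr (density sphere_measure (\<lambda>u. ennreal (1 / norm (T u) ^ CARD('n)))) sphere_borel (\<lambda>u. sgn (T u))
   = density sphere_measure (\<lambda>_. ennreal (1 / \<bar>det (matrix T)\<bar>))"
  (is "?L = ?R")
proof (rule measure_eqI)
  show "sets ?L = sets ?R" by (simp add: sets_sphere_measure)
  fix A assume "A \<in> sets ?L"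
  hence A: "A \<in> sets sphere_borel" by simp
  hence [measurable]: "A \<in> sets borel" by (simp add: sets_restrict_space_iff)
  have [measurable]: "(sgn :: real^'n \<Rightarrow> _) \<in> borel_measurable borel"
    unfolding sgn_div_norm by measurable
  \<comment> \<open>The extension of the indicator of \<open>A\<close> that is constant along rays,
    as the exchange of bodies requires.\<close>
  define G :: "real^'n \<Rightarrow> ennreal" where "G = (\<lambda>y. indicator A (sgn y))"
  have [measurable]: "G \<in> borel_measurable borel" unfolding G_def by measurable
  define n where "n = CARD('n)"
  note Sm [measurable] = linear_iso.measurable_T[OF swap]
  have [measurable]: "(\<lambda>u. 1 / norm (T u) ^ n) \<in> borel_measurable sphere_borel"
      by (rule measurable_restrict_space1) measurable
  have [measurable]: "(\<lambda>u. indicator A (sgn (T u)) :: ennreal) \<in> borel_measurable sphere_borel"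
      by (rule measurable_compose[OF measurable_sgn_T borel_measurable_indicator[OF A]])
  have "emeasure ?L A = (\<integral>\<^sup>+u. ennreal (1 / norm (T u) ^ n) * indicator A (sgn (T u)) \<partial>sphere_measure)"
  proof -
    have "emeasure ?L A = (\<integral>\<^sup>+v. indicator A v \<partial>?L)"
      using A by simp
    also have "\<dots> = (\<integral>\<^sup>+u. indicator A (sgn (T u)) \<partial>density sphere_measure (\<lambda>u. ennreal (1 / norm (T u) ^ CARD('n))))"
      by (rule nn_integral_distr)
        (simp_all only: measurable_density_eq1 measurable_sphere_measure measurable_sgn_T
          borel_measurable_indicator[OF A] measurable_distr_eq1)
    also have "\<dots> = (\<integral>\<^sup>+u. ennreal (1 / norm (T u) ^ n) * indicator A (sgn (T u)) \<partial>sphere_measure)"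
      unfolding n_def[symmetric] by (intro nn_integral_density; unfold measurable_sphere_measure; measurable)
    finally show ?thesis .
  qed
  also have "\<dots> = of_nat n * (\<integral>\<^sup>+x. (ennreal (1 / norm (T (sgn x)) ^ n) * indicator A (sgn (T (sgn x)))) * indicator (ball 0 1 - {0}) x \<partial>lborel)"
    unfolding n_def by (rule nn_integral_sphere_measure[folded n_def]) (unfold n_def[symmetric], measurable)
  also have "(\<integral>\<^sup>+x. (ennreal (1 / norm (T (sgn x)) ^ n) * indicator A (sgn (T (sgn x)))) * indicator (ball 0 1 - {0}) x \<partial>lborel)
     = (\<integral>\<^sup>+x. G (T x) * ennreal ((norm (S (T x)) / norm (T x)) ^ n) * indicator ({y. norm (S y) < 1} - {0}) (T x) \<partial>lborel)"
  proof (rule nn_integral_cong)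
    fix x :: "real^'n"
    show "(ennreal (1 / norm (T (sgn x)) ^ n) * indicator A (sgn (T (sgn x)))) * indicator (ball 0 1 - {0}) x
      = G (T x) * ennreal ((norm (S (T x)) / norm (T x)) ^ n) * indicator ({y. norm (S y) < 1} - {0}) (T x)"
    proof (cases "x = 0")
      case False
      have "sgn (T (sgn x)) = sgn (T x)" using False
        by (simp add: sgn_div_norm linear_scale[OF linT])
      moreover have "1 / norm (T (sgn x)) ^ n = (norm x / norm (T x)) ^ n"
        using False by (simp add: sgn_div_norm linear_scale[OF linT] power_divide power_mult_distrib field_simps)
      ultimately show ?thesis
        by (simp add: G_def mult.commute split: split_indicator)
    qed simp
  qed
  \<comment> \<open>The determinant is inserted together with its reciprocal, so that one factor
    completes the change of variables and the other remains as the constant on the right.\<close>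
  also have "\<dots> = ennreal (1 / \<bar>det (matrix T)\<bar>) * (ennreal \<bar>det (matrix T)\<bar> * \<dots>)"
    using det_T by (simp add: mult.assoc[symmetric] flip: ennreal_mult)
  also have "ennreal \<bar>det (matrix T)\<bar> * (\<integral>\<^sup>+x. G (T x) * ennreal ((norm (S (T x)) / norm (T x)) ^ n) * indicator ({y. norm (S y) < 1} - {0}) (T x) \<partial>lborel)
     = (\<integral>\<^sup>+y. G y * ennreal ((norm (S y) / norm y) ^ n) * indicator ({y. norm (S y) < 1} - {0}) y \<partial>lborel)"
    by (rule nn_integral_linear_substitution[OF linT det_T, symmetric]) measurable
  also have "\<dots> = (\<integral>\<^sup>+y. G y * indicator (ball 0 1 - {0}) y \<partial>lborel)"
    unfolding n_def
  proof (rule nn_integral_star_body_exchange[symmetric])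
    show "G (s *\<^sub>R y) = G y" if "s > 0" for s y
      using that by (simp add: G_def sgn_scaleR)
    show "norm (S (s *\<^sub>R y)) = s * norm (S y)" if "s > 0" for s y
      using that by (simp add: linear_scale[OF linS])
    show "norm (S y) > 0" if "y \<noteq> 0" for y
      using that linear_iso.eq_0_iff[OF swap] by simp
  qed measurable
  also have "of_nat n * (ennreal (1 / \<bar>det (matrix T)\<bar>) * (\<integral>\<^sup>+y. G y * indicator (ball 0 1 - {0}) y \<partial>lborel))
     = ennreal (1 / \<bar>det (matrix T)\<bar>) * emeasure sphere_measure A"
    using nn_integral_sphere_measure[of "indicator A"] A
    by (simp add: G_def n_def mult.left_commute measurable_sphere_measure sets_sphere_measure)
  also have "\<dots> = emeasure ?R A"
  proof -
    have "A \<in> sets sphere_measure" using A by (simp add: sets_sphere_measure)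
    then show ?thesis by (simp add: emeasure_density nn_integral_cmult_indicator)
  qed
  finally show "emeasure ?L A = emeasure ?R A" .
qed

text \<open>For a non-measurable \<open>g\<close> both integrals are \<open>0\<close>, since \<open>u \<mapsto> sgn (T u)\<close> is a homeomorphism of the sphere.\<close>
lemma integral_sphere_measure_substitution:
  fixes g :: "real^'n \<Rightarrow> real"
  shows "(\<integral>u. 1 / norm (T u) ^ CARD('n) * g (sgn (T u)) \<partial>sphere_measure)
       = 1 / \<bar>det (matrix T)\<bar> * (\<integral>u. g u \<partial>sphere_measure)"
proof (cases "g \<in> borel_measurable sphere_borel")
  case g [measurable]: True
  define n where "n = CARD('n)"
  have [measurable]: "(\<lambda>u. 1 / norm (T u) ^ n) \<in> borel_measurable sphere_borel"
    by (rule measurable_restrict_space1) measurable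
  have "(\<integral>u. 1 / norm (T u) ^ n * g (sgn (T u)) \<partial>sphere_measure)
     = (\<integral>u. g (sgn (T u)) \<partial>density sphere_measure (\<lambda>u. ennreal (1 / norm (T u) ^ n)))"
    by (subst integral_density) (simp_all add: measurable_sphere_measure)
  also have "\<dots> = (\<integral>v. g v \<partial>distr (density sphere_measure (\<lambda>u. ennreal (1 / norm (T u) ^ n))) sphere_borel (\<lambda>u. sgn (T u)))"
    by (rule integral_distr[symmetric]) (simp_all add: measurable_sphere_measure)
  also have "\<dots> = (\<integral>v. 1 / \<bar>det (matrix T)\<bar> * g v \<partial>sphere_measure)"
    unfolding n_def distr_density_sphere_measure
    by (subst integral_density) (simp_all add: measurable_sphere_measure)
  finally show ?thesis by (simp add: n_def)
next
  case False
  define h where "h = (\<lambda>u. 1 / norm (T u) ^ CARD('n) * g (sgn (T u)))"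
  have "h \<notin> borel_measurable sphere_borel"
  proof
    assume h [measurable]: "h \<in> borel_measurable sphere_borel"
    note [measurable] = linear_iso.measurable_sgn_T[OF swap]
    have [measurable]: "(\<lambda>u. norm (T u) ^ CARD('n)) \<in> borel_measurable sphere_borel"
      by (rule measurable_restrict_space1) measurable
    \<comment> \<open>This expression recovers \<open>g\<close> from \<open>h\<close> on the sphere,
      since \<open>u = sgn (S v)\<close> satisfies \<open>sgn (T u) = v\<close>. Measurability of
      \<open>h\<close> would therefore pass to \<open>g\<close>.\<close>
    have "(\<lambda>v. norm (T (sgn (S v))) ^ CARD('n) * h (sgn (S v))) \<in> borel_measurable sphere_borel"
      by measurable
    also have "?this \<longleftrightarrow> g \<in> borel_measurable sphere_borel"
    proof (rule measurable_cong)
      fix v :: "real^'n" assume "v \<in> space sphere_borel"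
      hence v: "v \<noteq> 0" "sgn v = v" by (auto simp: space_restrict_space sgn_div_norm)
      have "T (sgn (S v)) \<noteq> 0" using v linear_iso.eq_0_iff[OF swap, of v] by (simp add: sgn_zero_iff)
      then show "norm (T (sgn (S v))) ^ CARD('n) * h (sgn (S v)) = g v"
        using v by (simp add: h_def)
    qed
    finally show False using False by simp
  qed
  hence "\<not> integrable sphere_measure h"
    using borel_measurable_integrable[of sphere_measure h] by (auto simp: measurable_sphere_measure)
  moreover have "\<not> integrable sphere_measure g"
    using False borel_measurable_integrable[of sphere_measure g] by (auto simp: measurable_sphere_measure)
  ultimately show ?thesis by (simp add: not_integrable_integral_eq h_def)
qed

end

section \<open>Mixed affine surface area\<close>

lemma norm_eq_1_of_space_sphere_measure: "u \<in> space sphere_measure \<Longrightarrow> norm u = 1"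
  by (simp add: sphere_measure_def space_scale_measure space_restrict_space)

text \<open>All the geometry is collected here; the two claims of the theorem differ only in how the
  factor \<open>1 / (det T)^2\<close> is removed from the arguments of the
  \<open>\<phi> i\<close>.\<close>

lemma (in linear_iso) mixed_affine_surface_area_image:
  assumes K: "\<forall>i\<in>{1..CARD('n)}. K i \<in> C2_plus"
  shows "mixed_affine_surface_area \<phi> (\<lambda>i. T ` K i) = \<bar>det (matrix T)\<bar> *
    (\<integral>u. (\<Prod>i=1..CARD('n).
        (\<phi> i (1 / (det (matrix T))\<^sup>2 * (1 / (curvature_function (K i) u * support_function (K i) u ^ (CARD('n) + 1))))
          * support_function (K i) u * curvature_function (K i) u) powr (1 / CARD('n)))
      \<partial>sphere_measure)"
proof -
  interpret adj: linear_iso "adjoint T" "adjoint S" using adjoint_iso .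
  define n where "n = CARD('n)"
  have n: "n > 0" by (simp add: n_def)
  define d where "d = det (matrix T)"
  have d: "d \<noteq> 0" using det_T by (simp add: d_def)
  define h f where "h = (\<lambda>i. support_function (K i))" and "f = (\<lambda>i. curvature_function (K i))"
  define g where "g = (\<lambda>u. \<Prod>i=1..n. (\<phi> i (1 / d\<^sup>2 * (1 / (f i u * h i u ^ (n + 1)))) * h i u * f i u) powr (1 / n))"
  have "(\<Prod>i=1..n. (\<phi> i (1 / (curvature_function (T ` K i) u * support_function (T ` K i) u ^ (n + 1)))
          * support_function (T ` K i) u * curvature_function (T ` K i) u) powr (1 / n))
     = d\<^sup>2 * (1 / norm (adjoint T u) ^ n * g (sgn (adjoint T u)))"
    if "u \<in> space sphere_measure" for u
  proof -
    have u: "norm u = 1" using norm_eq_1_of_space_sphere_measure[OF that] .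
    define v where "v = sgn (adjoint T u)"
    define b where "b = norm (adjoint T u)"
    have "u \<noteq> 0" using u by auto
    hence b: "b > 0" by (simp add: b_def)
    have "(\<phi> i (1 / (curvature_function (T ` K i) u * support_function (T ` K i) u ^ (n + 1)))
          * support_function (T ` K i) u * curvature_function (T ` K i) u) powr (1 / n)
       = (d\<^sup>2 / b ^ n) powr (1 / n) * (\<phi> i (1 / d\<^sup>2 * (1 / (f i v * h i v ^ (n + 1)))) * h i v * f i v) powr (1 / n)"
      if i: "i \<in> {1..n}" for i
    proof -
      have Ki: "K i \<in> C2_plus" using K i by (simp add: n_def)
      have H: "support_function (T ` K i) u = b * h i v"
        using support_function_image[OF Ki u] by (simp add: b_def h_def v_def)
      have F: "curvature_function (T ` K i) u = d\<^sup>2 / b ^ (n + 1) * f i v"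
        using curvature_function_image[OF Ki u] by (simp add: b_def f_def v_def n_def d_def)
      \<comment> \<open>In the argument of \<open>\<phi> i\<close> the powers of \<open>b\<close>
        cancel completely. Outside, only one power of \<open>b\<close> meets
        \<open>b ^ (n + 1)\<close>, which leaves \<open>b ^ n\<close> in the denominator.\<close>
      have e1: "1 / (d\<^sup>2 / b ^ (n + 1) * f i v * (b * h i v) ^ (n + 1)) = 1 / d\<^sup>2 * (1 / (f i v * h i v ^ (n + 1)))"
        using b by (simp add: power_mult_distrib)
      have e2: "x * (b * h i v) * (d\<^sup>2 / b ^ (n + 1) * f i v) = (d\<^sup>2 / b ^ n) * (x * h i v * f i v)" for x
        using b by (simp add: field_simps)
      show ?thesis
        unfolding H F e1 e2 by (rule powr_mult)
    qed
    hence "(\<Prod>i=1..n. (\<phi> i (1 / (curvature_function (T ` K i) u * support_function (T ` K i) u ^ (n + 1)))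
          * support_function (T ` K i) u * curvature_function (T ` K i) u) powr (1 / n))
      = (\<Prod>i=1..n. (d\<^sup>2 / b ^ n) powr (1 / n) * (\<phi> i (1 / d\<^sup>2 * (1 / (f i v * h i v ^ (n + 1)))) * h i v * f i v) powr (1 / n))"
      by (rule prod.cong[OF refl])
    also have "\<dots> = ((d\<^sup>2 / b ^ n) powr (1 / n)) ^ n * g v"
      by (simp add: prod.distrib g_def)
    also have "((d\<^sup>2 / b ^ n) powr (1 / n)) ^ n = d\<^sup>2 / b ^ n"
      using b d n by (simp add: powr_power)
    finally show ?thesis by (simp add: b_def v_def)
  qed
  hence "mixed_affine_surface_area \<phi> (\<lambda>i. T ` K i)
     = (\<integral>u. d\<^sup>2 * (1 / norm (adjoint T u) ^ n * g (sgn (adjoint T u))) \<partial>sphere_measure)"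
    unfolding mixed_affine_surface_area_def n_def[symmetric] by (rule Bochner_Integration.integral_cong[OF refl])
  \<comment> \<open>The substitution on the sphere is made for the adjoint, whose determinant is
    also \<open>d\<close>; its factor \<open>1 / \<bar>d\<bar>\<close> reduces \<open>d^2\<close> to
    \<open>\<bar>d\<bar>\<close>.\<close>
  also have "\<dots> = d\<^sup>2 * (1 / \<bar>det (matrix (adjoint T))\<bar> * (\<integral>u. g u \<partial>sphere_measure))"
    unfolding n_def adj.integral_sphere_measure_substitution[symmetric] by (rule integral_mult_right_zero)
  also have "\<dots> = \<bar>d\<bar> * (\<integral>u. g u \<partial>sphere_measure)"
  proof -
    have "det (matrix (adjoint T)) = d" by (simp add: d_def matrix_adjoint[OF linT])
    moreover have "d\<^sup>2 * (1 / \<bar>d\<bar>) = \<bar>d\<bar>"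
      using d by (cases "d > 0") (auto simp: power2_eq_square)
    ultimately show ?thesis by (simp only: mult.assoc[symmetric])
  qed
  finally show ?thesis by (simp add: g_def n_def d_def h_def f_def)
qed

theorem theorem2p2:
  fixes T :: "real ^ 'n \<Rightarrow> real ^ 'n"
    and \<phi> :: "nat \<Rightarrow> real \<Rightarrow> real"
    and K :: "nat \<Rightarrow> (real ^ 'n) set"
  assumes "CARD('n) \<ge> 2"
    and "linear T" and "bij T"
    and "\<forall>i\<in>{1..CARD('n)}. \<phi> i \<in> Conc"
    and "\<forall>i\<in>{1..CARD('n)}. K i \<in> C2_plus"
  shows "(\<bar>det (matrix T)\<bar> = 1 \<longrightarrow>
            mixed_affine_surface_area \<phi> (\<lambda>i. T ` K i) = mixed_affine_surface_area \<phi> K) \<and>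
         (\<forall>r :: nat \<Rightarrow> real.
            (\<forall>i\<in>{1..CARD('n)}. 0 \<le> r i \<and> r i < 1 \<and> homogeneous_of_degree (r i) (\<phi> i)) \<longrightarrow>
            mixed_affine_surface_area \<phi> (\<lambda>i. T ` K i) =
              \<bar>det (matrix T)\<bar> powr (1 - 2 * (\<Sum>i=1..CARD('n). r i) / CARD('n))
                * mixed_affine_surface_area \<phi> K)"
proof -
  obtain S where "linear S" "T \<circ> S = id" "S \<circ> T = id"
    using linear_injective_isomorphism[OF assms(2) bij_is_inj[OF assms(3)]] by (auto simp: fun_eq_iff)
  then interpret linear_iso T S
    using assms(2) by (intro linear_iso.intro) (auto simp: fun_eq_iff)
  define n where "n = CARD('n)"
  have n: "n > 0" by (simp add: n_def)
  define d where "d = \<bar>det (matrix T)\<bar>"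
  have d: "d > 0" "(det (matrix T))\<^sup>2 = d\<^sup>2" using det_T by (auto simp: d_def)
  note image = mixed_affine_surface_area_image[OF assms(5), of \<phi>, folded n_def, folded d_def, unfolded d(2)]
  have "mixed_affine_surface_area \<phi> (\<lambda>i. T ` K i) = mixed_affine_surface_area \<phi> K" if "d = 1"
    unfolding image that by (simp add: mixed_affine_surface_area_def n_def)
  moreover have "mixed_affine_surface_area \<phi> (\<lambda>i. T ` K i) =
      d powr (1 - 2 * (\<Sum>i=1..n. r i) / n) * mixed_affine_surface_area \<phi> K"
    if hom: "\<forall>i\<in>{1..n}. 0 \<le> r i \<and> r i < 1 \<and> homogeneous_of_degree (r i) (\<phi> i)" for r
  proof -
    define t where "t = (\<lambda>i u. 1 / (curvature_function (K i) u * support_function (K i) u ^ (n + 1)))"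
    have "(\<Prod>i=1..n. (\<phi> i (1 / d\<^sup>2 * t i u) * support_function (K i) u * curvature_function (K i) u) powr (1 / n))
       = d powr (- 2 * (\<Sum>i=1..n. r i) / n) *
         (\<Prod>i=1..n. (\<phi> i (t i u) * support_function (K i) u * curvature_function (K i) u) powr (1 / n))"
      if "u \<in> space sphere_measure" for u
    proof -
      have u: "norm u = 1" using norm_eq_1_of_space_sphere_measure[OF that] .
      have "(\<phi> i (1 / d\<^sup>2 * t i u) * support_function (K i) u * curvature_function (K i) u) powr (1 / n)
         = d powr (- 2 * r i / n) * (\<phi> i (t i u) * support_function (K i) u * curvature_function (K i) u) powr (1 / n)"
        if i: "i \<in> {1..n}" for i
      proof -
        have Ki: "K i \<in> C2_plus" using assms(5) i by (simp add: n_def)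
        \<comment> \<open>Homogeneity speaks of positive arguments only, so the curvature and
          support functions must be known to be positive at \<open>u\<close>.\<close>
        have "t i u > 0"
          using C2_plus_curvature_function_pos[OF Ki u] C2_plus_support_function_pos[OF Ki u] by (simp add: t_def)
        moreover have "1 / d\<^sup>2 > 0" using d by simp
        moreover have "homogeneous_of_degree (r i) (\<phi> i)" using hom i by blast
        ultimately have "\<phi> i (1 / d\<^sup>2 * t i u) = (1 / d\<^sup>2) powr r i * \<phi> i (t i u)"
          unfolding homogeneous_of_degree_def by blast
        also have "(1 / d\<^sup>2) powr r i = d powr (- 2 * r i)"
        proof -
          have "1 / d\<^sup>2 = d powr (- 2)" using d by (simp add: powr_minus_divide)
          then show ?thesis by (simp add: powr_powr)
        qed
        finally have eq: "\<phi> i (1 / d\<^sup>2 * t i u) = d powr (- 2 * r i) * \<phi> i (t i u)" .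
        show ?thesis
          unfolding eq by (simp only: powr_mult powr_powr mult.assoc times_divide_eq_right mult_1_right)
      qed
      hence "(\<Prod>i=1..n. (\<phi> i (1 / d\<^sup>2 * t i u) * support_function (K i) u * curvature_function (K i) u) powr (1 / n))
        = (\<Prod>i=1..n. d powr (- 2 * r i / n) * (\<phi> i (t i u) * support_function (K i) u * curvature_function (K i) u) powr (1 / n))"
        by (rule prod.cong[OF refl])
      also have "\<dots> = d powr (\<Sum>i=1..n. - 2 * r i / n) *
         (\<Prod>i=1..n. (\<phi> i (t i u) * support_function (K i) u * curvature_function (K i) u) powr (1 / n))"
        using d by (simp add: prod.distrib powr_sum)
      also have "(\<Sum>i=1..n. - 2 * r i / n) = - 2 * (\<Sum>i=1..n. r i) / n"
        by (simp add: sum_distrib_left sum_divide_distrib sum_negf)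
      finally show ?thesis .
    qed
    hence "(\<integral>u. (\<Prod>i=1..n. (\<phi> i (1 / d\<^sup>2 * t i u) * support_function (K i) u * curvature_function (K i) u) powr (1 / n)) \<partial>sphere_measure)
      = (\<integral>u. d powr (- 2 * (\<Sum>i=1..n. r i) / n) *
         (\<Prod>i=1..n. (\<phi> i (t i u) * support_function (K i) u * curvature_function (K i) u) powr (1 / n)) \<partial>sphere_measure)"
      by (rule Bochner_Integration.integral_cong[OF refl])
    hence "mixed_affine_surface_area \<phi> (\<lambda>i. T ` K i) = d * (\<integral>u. d powr (- 2 * (\<Sum>i=1..n. r i) / n) *
         (\<Prod>i=1..n. (\<phi> i (t i u) * support_function (K i) u * curvature_function (K i) u) powr (1 / n)) \<partial>sphere_measure)"
      unfolding image by (simp only: t_def)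
    also have "\<dots> = (d * d powr (- 2 * (\<Sum>i=1..n. r i) / n)) * mixed_affine_surface_area \<phi> K"
      by (simp add: mixed_affine_surface_area_def t_def n_def)
    \<comment> \<open>The geometric factor \<open>d\<close> contributes the 1 in the exponent. Each
      \<open>\<phi> i\<close> contributes \<open>-2 * r i / n\<close>, from \<open>d^(-2)\<close>
      raised to its degree and then to the power 1/n.\<close>
    also have "d * d powr (- 2 * (\<Sum>i=1..n. r i) / n) = d powr (1 - 2 * (\<Sum>i=1..n. r i) / n)"
      using d powr_add[of d 1 "- 2 * (\<Sum>i=1..n. r i) / n"] by simp
    finally show ?thesis .
  qed
  ultimately show ?thesis by (auto simp: n_def d_def)
qed

end
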